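(* Let $\mathcal{G}=(\mathcal{V},\mathcal{E})$ (spatial graph) and $G=(V,E)$ (opinion graph) be finite connected graphs, let $\mathbf{r}$ and $\mathbf{d}$ be the radius and diameter of $G$, and let $\epsilon(a)$ be the eccentricity of $a\in V$. Let $(\xi_t)$ be the imitation process with confidence threshold $\tau\in\mathbb{N}$, started from an arbitrary (possibly random) initial configuration $\xi_0$, and let $T$ be its time to fixation. Assume $\tau\in[\mathbf{r},\mathbf{d})$. Then $$P(\xi_T\equiv\mathrm{cst})\ \ge\ \frac{E\big(\mathrm{card}\{x\in\mathcal{V}:\epsilon(\xi_0(x))\le\tau\}\big)}{\mathrm{card}(\mathcal{V})}.$$ In particular, if $\xi_0$ is distributed according to the uniform product measure, then $$P(\xi_T\equiv\mathrm{cst})\ \ge\ \frac{\mathrm{card}\{a\in V:\epsilon(a)\le\tau\}}{\mathrm{card}(V)}\ >\ 0.$$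
   Context: Graphs are simple and undirected; $\mathbb{N}=\{0,1,2,\dots\}$. $d(\cdot,\cdot)$ is the geodesic distance on the opinion graph $G$. The eccentricity of $a\in V$ is $\epsilon(a)=\max_{b\in V}d(a,b)$; $\mathbf{r}=\min_{a\in V}\epsilon(a)$ and $\mathbf{d}=\max_{a\in V}\epsilon(a)$. Let $\vec{\mathcal{E}}$ be the set of directed edges $\vec{xy},\vec{yx}$ for $\{x,y\}\in\mathcal{E}$. The imitation process $(\xi_t)$ is the continuous-time Markov chain on $V^{\mathcal{V}}$ (an opinion in $V$ at each vertex of $\mathcal{V}$), with right-continuous paths, in which each directed edge $\vec{xy}\in\vec{\mathcal{E}}$ becomes active at rate one, independently over directed edges and independently of $\xi_0$. When $\vec{xy}$ becomes active and the opinions $a$ at $x$ and $b$ at $y$ satisfy $0<d(a,b)\le\tau$, the opinion at $x$ becomes $b$; otherwise nothing changes. The time to fixation is $T=\inf\{t\ge0:\xi_t=\xi_s\text{ for all }s>t\}$ (with $\inf\varnothing=\infty$). The event $\{\xi_T\equiv\mathrm{cst}\}$ is the event that $T<\infty$ and there is $c\in V$ with $\xi_T(x)=c$ for all $x\in\mathcal{V}$. The uniform product measure is the initial distribution under which the opinions $\xi_0(x)$, $x\in\mathcal{V}$, are independent and uniformly distributed on $V$. *)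

theory Defs
  imports
    "HOL-Probability.Probability"
    "Graph_Theory.Pair_Digraph"
    "Graph_Theory.Digraph_Component"
begin

text \<open>
  A finite simple undirected graph is a \<^const>\<open>pair_graph\<close>: a finite, loop-free digraph whose arc set
  \<^const>\<open>parcs\<close> is symmetric.  An undirected edge is thus a pair of opposite arcs, and
  \<^const>\<open>parcs\<close> is the set of directed edges.
\<close>

text \<open>
  An infimum over natural numbers, hence meaningful only for vertices that are joined by a walk
  (the infimum of the empty set is \<open>0\<close>).
\<close>

definition geodesic_dist :: "'o pair_pre_digraph \<Rightarrow> 'o \<Rightarrow> 'o \<Rightarrow> nat" where
  "geodesic_dist G a b = (INF p\<in>{p. pre_digraph.awalk (with_proj G) a p b}. length p)"

definition eccentricity :: "'o pair_pre_digraph \<Rightarrow> 'o \<Rightarrow> nat" where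
  "eccentricity G a = Max (geodesic_dist G a ` pverts G)"

definition graph_radius :: "'o pair_pre_digraph \<Rightarrow> nat" where
  "graph_radius G = Min (eccentricity G ` pverts G)"

definition graph_diameter :: "'o pair_pre_digraph \<Rightarrow> nat" where
  "graph_diameter G = Max (eccentricity G ` pverts G)"

definition imitate :: "'o pair_pre_digraph \<Rightarrow> nat \<Rightarrow> 'v \<times> 'v \<Rightarrow> ('v \<Rightarrow> 'o) \<Rightarrow> ('v \<Rightarrow> 'o)" where
  "imitate G \<tau> e \<eta> =
     (let a = \<eta> (fst e); b = \<eta> (snd e)
      in if 0 < geodesic_dist G a b \<and> geodesic_dist G a b \<le> \<tau> then \<eta>(fst e := b) else \<eta>)"

text \<open>
  Time is \<open>[0, \<infinity>)\<close>; values of the processes at negative reals are irrelevant throughout.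
  Discrete-valued paths are right-continuous at \<open>t\<close> iff they are constant just after \<open>t\<close>.
\<close>

definition poisson_process :: "'w measure \<Rightarrow> real \<Rightarrow> (real \<Rightarrow> 'w \<Rightarrow> nat) \<Rightarrow> bool" where
  "poisson_process M rate N \<longleftrightarrow>
     (\<forall>t\<ge>0. N t \<in> M \<rightarrow>\<^sub>M count_space UNIV) \<and>
     (\<forall>\<omega>\<in>space M. N 0 \<omega> = 0 \<and> mono_on {0..} (\<lambda>t. N t \<omega>) \<and>
        (\<forall>t\<ge>0. \<forall>\<^sub>F s in at_right t. N s \<omega> = N t \<omega>)) \<and>
     (\<forall>s\<ge>0. \<forall>t>s. distr M (count_space UNIV) (\<lambda>\<omega>. N t \<omega> - N s \<omega>)
        = measure_pmf (poisson_pmf (rate * (t - s)))) \<and>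
     (\<forall>(u :: nat \<Rightarrow> real) n. 0 \<le> u 0 \<and> mono u \<longrightarrow>
        prob_space.indep_vars M (\<lambda>_. count_space UNIV)
          (\<lambda>i \<omega>. N (u (Suc i)) \<omega> - N (u i) \<omega>) {..<n})"

definition jumps_at :: "(real \<Rightarrow> 'w \<Rightarrow> nat) \<Rightarrow> 'w \<Rightarrow> real \<Rightarrow> bool" where
  "jumps_at N \<omega> t \<longleftrightarrow> 0 < t \<and> (\<forall>s\<in>{0..<t}. N s \<omega> < N t \<omega>)"

abbreviation configurations :: "'v pair_pre_digraph \<Rightarrow> 'o pair_pre_digraph \<Rightarrow> ('v \<Rightarrow> 'o) set" where
  "configurations S G \<equiv> pverts S \<rightarrow>\<^sub>E pverts G"

abbreviation nat_paths :: "(real \<Rightarrow> nat) measure" where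
  "nat_paths \<equiv> \<Pi>\<^sub>M t\<in>{0..}. count_space UNIV"

text \<open>
  \<open>S\<close> is the spatial graph, \<open>G\<close> the opinion graph, and \<open>N e\<close> counts the activations of the directed
  edge \<open>e\<close>.  In the last assumption \<open>\<eta>\<close> is the left limit of the path at \<open>t\<close>.  That assumption is
  required almost surely because two directed edges may be active at the same time on a null set.
\<close>

locale imitation_process = prob_space M
  for M :: "'w measure"
    and S :: "'v pair_pre_digraph"
    and G :: "'o pair_pre_digraph"
    and \<tau> :: nat
    and N :: "'v \<times> 'v \<Rightarrow> real \<Rightarrow> 'w \<Rightarrow> nat"
    and \<xi> :: "real \<Rightarrow> 'w \<Rightarrow> 'v \<Rightarrow> 'o" +
  assumes measurable_state:
      "0 \<le> t \<Longrightarrow> \<xi> t \<in> M \<rightarrow>\<^sub>M count_space (configurations S G)"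
    and right_continuous:
      "\<omega> \<in> space M \<Longrightarrow> 0 \<le> t \<Longrightarrow> \<forall>\<^sub>F s in at_right t. \<xi> s \<omega> = \<xi> t \<omega>"
    and rate_one:
      "e \<in> parcs S \<Longrightarrow> poisson_process M 1 (N e)"
    and indep_edges:
      "indep_vars (\<lambda>_. nat_paths) (\<lambda>e \<omega>. \<lambda>t\<in>{0..}. N e t \<omega>) (parcs S)"
    and indep_initial:
      "indep_set
         (sets (vimage_algebra (space M) (\<xi> 0) (count_space (configurations S G))))
         (sets (vimage_algebra (space M) (\<lambda>\<omega>. \<lambda>e\<in>parcs S. \<lambda>t\<in>{0..}. N e t \<omega>)
            (\<Pi>\<^sub>M e\<in>parcs S. nat_paths)))"
    and dynamics:
      "AE \<omega> in M. \<forall>t>0. \<exists>\<eta>. (\<forall>\<^sub>F s in at_left t. \<xi> s \<omega> = \<eta>) \<and>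
         (\<forall>e\<in>parcs S. jumps_at (N e) \<omega> t \<longrightarrow> \<xi> t \<omega> = imitate G \<tau> e \<eta>) \<and>
         ((\<forall>e\<in>parcs S. \<not> jumps_at (N e) \<omega> t) \<longrightarrow> \<xi> t \<omega> = \<eta>)"

definition fixation_time :: "(real \<Rightarrow> 'w \<Rightarrow> 'v \<Rightarrow> 'o) \<Rightarrow> 'w \<Rightarrow> ereal" where
  "fixation_time \<xi> \<omega> = Inf (ereal ` {t. 0 \<le> t \<and> (\<forall>s>t. \<xi> t \<omega> = \<xi> s \<omega>)})"

definition consensus_event ::
  "'w measure \<Rightarrow> 'v pair_pre_digraph \<Rightarrow> 'o pair_pre_digraph \<Rightarrow> (real \<Rightarrow> 'w \<Rightarrow> 'v \<Rightarrow> 'o) \<Rightarrow> 'w set" where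
  "consensus_event M S G \<xi> =
     {\<omega> \<in> space M. fixation_time \<xi> \<omega> < \<infinity> \<and>
        (\<exists>c\<in>pverts G. \<forall>x\<in>pverts S. \<xi> (real_of_ereal (fixation_time \<xi> \<omega>)) \<omega> x = c)}"

definition uniform_product_initial ::
  "'w measure \<Rightarrow> 'v pair_pre_digraph \<Rightarrow> 'o pair_pre_digraph \<Rightarrow> ('w \<Rightarrow> 'v \<Rightarrow> 'o) \<Rightarrow> bool" where
  "uniform_product_initial M S G \<xi>0 \<longleftrightarrow>
     prob_space.indep_vars M (\<lambda>_. count_space (pverts G)) (\<lambda>x \<omega>. \<xi>0 \<omega> x) (pverts S) \<and>
     (\<forall>x\<in>pverts S. distr M (count_space (pverts G)) (\<lambda>\<omega>. \<xi>0 \<omega> x) = uniform_count_measure (pverts G))"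

end

theory Submission
  imports Defs
begin

text \<open>
  Call an opinion \<open>a\<close> central if its eccentricity is at most \<open>\<tau>\<close>.  A central opinion interacts with
  every other one, so each spatial edge with exactly one end of opinion \<open>a\<close> creates and destroys a
  copy of \<open>a\<close> at the same rate: the number of vertices with opinion \<open>a\<close> is a bounded martingale.
  Its square gains at least the rate of one jump as long as both \<open>a\<close> and another opinion are present, so
  by boundedness the count ends in \<open>0\<close> or \<open>card (pverts S)\<close>.  Hence the probability of a consensus on \<open>a\<close>
  is at least the expected initial proportion of \<open>a\<close>, and it remains to sum over central \<open>a\<close>.

  To avoid generators and the strong Markov property, the process is compared with a chain of
  mesh \<open>h\<close> that performs an imitation step only if exactly one arc is activated, exactly once, in the
  time slot.  For this chain the martingale identity is exact for every \<open>h\<close>, by symmetry of the arcs,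
  and it differs from the process only if some slot contains two activations, which up to time
  \<open>n h\<close> has probability \<open>O(n h\<^sup>2)\<close>.  With \<open>h = 1 / m\<^sup>2\<close> and \<open>n = m\<^sup>3\<close> all errors are \<open>O(1/m)\<close>.
\<close>

section \<open>Opinion counts under one imitation step\<close>

lemma pair_graph_connected_imp_awalk:
  assumes "pair_graph G" "Digraph_Component.connected (with_proj G)" "a \<in> pverts G" "b \<in> pverts G"
  shows "\<exists>p. pre_digraph.awalk (with_proj G) a p b"
proof -
  interpret pair_graph G by fact
  \<comment> \<open>\<open>connected\<close> refers to the underlying undirected graph; as the arc
    set is symmetric, it yields directed walks. They keep the infimum in
    \<open>geodesic_dist\<close> from ranging over the empty set.\<close>
  have "strongly_connected (with_proj G)"
    using symmetric_connected_imp_strongly_connected pair_sym_arcs assms(2) by blast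
  then have "a \<rightarrow>\<^sup>*\<^bsub>with_proj G\<^esub> b"
    using assms(3,4) by (auto simp: strongly_connected_def)
  then show ?thesis
    by (simp add: reachable_awalk)
qed

text \<open>Reversing the list and swapping every arc traverses the walk backwards. This concerns
  only how the arcs chain up; that the swapped arcs lie in the graph is a matter of the symmetry of
  \<open>parcs\<close>.\<close>

lemma pcas_rev: "pcas u p v \<Longrightarrow> pcas v (rev (map prod.swap p)) u"
proof (induction p arbitrary: u)
  case (Cons e p)
  have app: "pcas x (q @ r) z \<longleftrightarrow> (\<exists>y. pcas x q y \<and> pcas y r z)" for x q r z
    by (induction q arbitrary: x) auto
  show ?case using Cons by (auto simp: app)
qed simp

text \<open>A shortest walk from \<open>a\<close> to \<open>b\<close>, reversed, is a walk from
  \<open>b\<close> to \<open>a\<close> of the same length. The existence assumption makes the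
  infimum an attained minimum.\<close>

lemma geodesic_dist_commute_le:
  assumes "pair_graph G" "a \<in> pverts G" "b \<in> pverts G"
    "\<exists>p. pre_digraph.awalk (with_proj G) a p b"
  shows "geodesic_dist G b a \<le> geodesic_dist G a b"
proof -
  interpret pair_graph G by fact
  let ?W = "{p. awalk a p b}"
  have "Inf (length ` ?W) \<in> length ` ?W"
    by (rule Inf_nat_def1) (use assms(4) in auto)
  then obtain p where p: "awalk a p b" "length p = geodesic_dist G a b"
    by (auto simp: geodesic_dist_def)
  have "awalk b (rev (map prod.swap p)) a"
    using p(1) assms(3) pcas_rev[of a p b] pair_sym_arcs
    by (auto simp: awalk_def symmetric_def sym_def)
  then have "geodesic_dist G b a \<le> length (rev (map prod.swap p))"
    unfolding geodesic_dist_def by (intro cINF_lower) auto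
  then show ?thesis using p(2) by simp
qed

lemma geodesic_dist_commute:
  assumes "pair_graph G" "Digraph_Component.connected (with_proj G)" "a \<in> pverts G" "b \<in> pverts G"
  shows "geodesic_dist G b a = geodesic_dist G a b"
  using assms by (intro antisym geodesic_dist_commute_le pair_graph_connected_imp_awalk)

text \<open>The infimum is attained by a walk, and a walk between distinct vertices is not
  empty.\<close>

lemma geodesic_dist_pos:
  assumes "pair_graph G" "Digraph_Component.connected (with_proj G)" "a \<in> pverts G" "b \<in> pverts G"
    and "a \<noteq> b"
  shows "0 < geodesic_dist G a b"
proof -
  interpret pair_graph G by fact
  have "Inf (length ` {p. awalk a p b}) \<in> length ` {p. awalk a p b}"
    by (rule Inf_nat_def1) (use pair_graph_connected_imp_awalk[OF assms(1-4)] in auto)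
  then obtain p where "awalk a p b" "length p = geodesic_dist G a b"
    by (auto simp: geodesic_dist_def)
  then show ?thesis using assms(5) by (cases p) (auto simp: awalk_def)
qed

lemma geodesic_dist_self:
  assumes "pair_graph G" "a \<in> pverts G"
  shows "geodesic_dist G a a = 0"
proof -
  interpret pair_graph G by fact
  have "geodesic_dist G a a \<le> length ([] :: ('a \<times> 'a) list)"
    unfolding geodesic_dist_def by (intro cINF_lower) (use assms(2) in \<open>auto simp: awalk_Nil_iff\<close>)
  then show ?thesis by simp
qed

lemma geodesic_dist_le_eccentricity:
  assumes "pair_graph G" "b \<in> pverts G"
  shows "geodesic_dist G a b \<le> eccentricity G a"
proof -
  interpret pair_graph G by fact
  show ?thesis unfolding eccentricity_def
    using assms(2) pair_finite_verts by (intro Max_ge) auto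
qed

text \<open>Distinct opinions are at positive distance, and for equal opinions the update writes
  back the opinion already present, so both forms agree.\<close>

lemma imitate_eq_if:
  assumes "pair_graph G" "Digraph_Component.connected (with_proj G)"
    and "\<eta> (fst e) \<in> pverts G" "\<eta> (snd e) \<in> pverts G"
  shows "imitate G \<tau> e \<eta> =
    (if geodesic_dist G (\<eta> (fst e)) (\<eta> (snd e)) \<le> \<tau> then \<eta>(fst e := \<eta> (snd e)) else \<eta>)"
  using geodesic_dist_pos[OF assms] by (cases "\<eta> (fst e) = \<eta> (snd e)")
   (auto simp: imitate_def Let_def)

lemma imitate_in_configurations:
  assumes "pair_graph S" "e \<in> parcs S" "\<eta> \<in> configurations S G"
  shows "imitate G \<tau> e \<eta> \<in> configurations S G"
proof -
  interpret pair_graph S by fact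
  show ?thesis
    using arc_fst_in_verts[OF assms(2)] arc_snd_in_verts[OF assms(2)] assms(3)
    by (auto simp: imitate_def Let_def PiE_iff extensional_def)
qed

section \<open>The number of vertices holding a given opinion\<close>

definition opinion_count :: "'v pair_pre_digraph \<Rightarrow> 'o \<Rightarrow> ('v \<Rightarrow> 'o) \<Rightarrow> nat" where
  "opinion_count S a \<eta> = card {x \<in> pverts S. \<eta> x = a}"

lemma opinion_count_le:
  "pair_graph S \<Longrightarrow> opinion_count S a \<eta> \<le> card (pverts S)"
  unfolding opinion_count_def pair_graph_def pair_digraph_def pair_fin_digraph_def pair_fin_digraph_axioms_def
  by (intro card_mono) auto

lemma opinion_count_eq_card_iff:
  assumes "pair_graph S"
  shows "opinion_count S a \<eta> = card (pverts S) \<longleftrightarrow> (\<forall>x\<in>pverts S. \<eta> x = a)"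
proof -
  interpret pair_graph S by fact
  have "opinion_count S a \<eta> = card (pverts S) \<longleftrightarrow> {x \<in> pverts S. \<eta> x = a} = pverts S"
    using card_subset_eq[OF pair_finite_verts, of "{x \<in> pverts S. \<eta> x = a}"]
    by (auto simp: opinion_count_def)
  then show ?thesis by auto
qed

text \<open>A central opinion is within the threshold of every opinion, so across an arc with exactly
  one end of opinion \<open>a\<close> every activation is effective.\<close>

lemma opinion_count_imitate:
  assumes "pair_graph S" "pair_graph G" "Digraph_Component.connected (with_proj G)"
    and a: "a \<in> pverts G" "eccentricity G a \<le> \<tau>"
    and \<eta>: "\<eta> \<in> configurations S G" and e: "(x, y) \<in> parcs S"
  shows "real (opinion_count S a (imitate G \<tau> (x, y) \<eta>))
    = real (opinion_count S a \<eta>) + (of_bool (\<eta> y = a) - of_bool (\<eta> x = a))"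
proof -
  interpret pair_graph S by fact
  have xy: "x \<in> pverts S" "y \<in> pverts S"
    using in_arcsD1[OF e] in_arcsD2[OF e] .
  then have \<eta>xy: "\<eta> x \<in> pverts G" "\<eta> y \<in> pverts G" using \<eta> by auto
  have central: "geodesic_dist G a b \<le> \<tau>" "geodesic_dist G b a \<le> \<tau>" if "b \<in> pverts G" for b
    using geodesic_dist_le_eccentricity[OF assms(2) that, of a] a(2)
      geodesic_dist_commute[OF assms(2,3) a(1) that] by auto
  have im: "imitate G \<tau> (x, y) \<eta> =
    (if geodesic_dist G (\<eta> x) (\<eta> y) \<le> \<tau> then \<eta>(x := \<eta> y) else \<eta>)"
    using imitate_eq_if[OF assms(2,3), of \<eta> "(x, y)" \<tau>] \<eta>xy by simp
  consider "\<eta> x = a" "\<eta> y = a" | "\<eta> x \<noteq> a" "\<eta> y \<noteq> a" | "\<eta> x = a" "\<eta> y \<noteq> a" | "\<eta> x \<noteq> a" "\<eta> y = a"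
    by blast
  then show ?thesis
  proof cases
    case 1
    then have "imitate G \<tau> (x, y) \<eta> = \<eta>" by (auto simp: im)
    then show ?thesis using 1 by simp
  next
    case 2
    then have "{v \<in> pverts S. imitate G \<tau> (x, y) \<eta> v = a} = {v \<in> pverts S. \<eta> v = a}"
      by (auto simp: im)
    then show ?thesis using 2 by (simp add: opinion_count_def)
  next
    case 3
    then have "{v \<in> pverts S. \<eta> v = a} = insert x {v \<in> pverts S. imitate G \<tau> (x, y) \<eta> v = a}"
      and "x \<notin> {v \<in> pverts S. imitate G \<tau> (x, y) \<eta> v = a}"
      using xy central[OF \<eta>xy(2)] by (auto simp: im)
    then have "opinion_count S a \<eta> = Suc (opinion_count S a (imitate G \<tau> (x, y) \<eta>))"
      using pair_finite_verts by (simp add: opinion_count_def)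
    then show ?thesis using 3 by simp
  next
    case 4
    then have "{v \<in> pverts S. imitate G \<tau> (x, y) \<eta> v = a} = insert x {v \<in> pverts S. \<eta> v = a}"
      and "x \<notin> {v \<in> pverts S. \<eta> v = a}"
      using xy central[OF \<eta>xy(1)] by (auto simp: im)
    then have "opinion_count S a (imitate G \<tau> (x, y) \<eta>) = Suc (opinion_count S a \<eta>)"
      using pair_finite_verts by (simp add: opinion_count_def)
    then show ?thesis using 4 by simp
  qed
qed

text \<open>If on every arc both ends or neither had opinion \<open>a\<close>, this would propagate
  along a walk from a vertex with opinion \<open>a\<close> to one without it.\<close>

lemma exists_boundary_arc:
  assumes S: "pair_graph S" "Digraph_Component.connected (with_proj S)"
    and pos: "0 < opinion_count S a \<eta>" and less: "opinion_count S a \<eta> < card (pverts S)"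
  shows "\<exists>(x, y)\<in>parcs S. (\<eta> x = a) \<noteq> (\<eta> y = a)"
proof (rule ccontr)
  interpret pair_graph S by fact
  assume "\<not> ?thesis"
  then have same: "\<eta> x = a \<longleftrightarrow> \<eta> y = a" if "(x, y) \<in> parcs S" for x y
    using that by fast
  obtain u where u: "u \<in> pverts S" "\<eta> u = a"
    using pos by (fastforce simp: opinion_count_def card_gt_0_iff)
  obtain v where v: "v \<in> pverts S" "\<eta> v \<noteq> a"
    using less opinion_count_eq_card_iff[OF S(1), of a \<eta>] by auto
  obtain p where "awalk u p v"
    using pair_graph_connected_imp_awalk[OF S u(1) v(1)] by auto
  then have "pcas u p v" "set p \<subseteq> parcs S" by (auto simp: awalk_def)
  then have "\<eta> u = a \<longleftrightarrow> \<eta> v = a"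
  proof (induction p arbitrary: u)
    case (Cons e p)
    then show ?case using same[of "fst e" "snd e"] by auto
  qed simp
  with u v show False by simp
qed

text \<open>An arc \<open>(x, y)\<close> changes the count by the indicator of \<open>a\<close> at
  \<open>y\<close> minus that at \<open>x\<close>, and the reversed arc by the opposite amount. The
  vanishing drift is the martingale property.\<close>

lemma sum_opinion_count_imitate:
  assumes "pair_graph S" "pair_graph G" "Digraph_Component.connected (with_proj G)"
    and "a \<in> pverts G" "eccentricity G a \<le> \<tau>" "\<eta> \<in> configurations S G"
  shows "(\<Sum>e\<in>parcs S. real (opinion_count S a (imitate G \<tau> e \<eta>)) - real (opinion_count S a \<eta>)) = 0"
proof -
  interpret pair_graph S by fact
  let ?i = "\<lambda>x. of_bool (\<eta> x = a) :: real"
  have sw: "bij_betw prod.swap (parcs S) (parcs S)"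
    using pair_sym_arcs
    by (intro bij_betw_byWitness[where f' = prod.swap]) (auto simp: symmetric_def sym_def)
  have "(\<Sum>e\<in>parcs S. real (opinion_count S a (imitate G \<tau> e \<eta>)) - real (opinion_count S a \<eta>))
    = (\<Sum>e\<in>parcs S. ?i (snd e) - ?i (fst e))"
  proof (intro sum.cong refl)
    fix e assume "e \<in> parcs S"
    then show "real (opinion_count S a (imitate G \<tau> e \<eta>)) - real (opinion_count S a \<eta>)
      = ?i (snd e) - ?i (fst e)"
      using opinion_count_imitate[OF assms, of "fst e" "snd e"] by simp
  qed
  also have "\<dots> = (\<Sum>e\<in>parcs S. ?i (snd e)) - (\<Sum>e\<in>parcs S. ?i (fst e))"
    by (simp add: sum_subtractf)
  \<comment> \<open>Reindexing by \<open>prod.swap\<close> turns the sum over second ends into the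
    sum over first ends.\<close>
  also have "(\<Sum>e\<in>parcs S. ?i (snd e)) = (\<Sum>e\<in>parcs S. ?i (fst e))"
    using sum.reindex_bij_betw[OF sw, of "\<lambda>e. ?i (fst e)"] by simp
  finally show ?thesis by simp
qed

text \<open>With \<delta> the change of the count \<open>f\<close>, each summand is
  \<open>2 * f * \<delta> + \<delta>\<^sup>2\<close>. The linear parts cancel by the zero drift, the
  squares are nonnegative, and a boundary arc contributes \<open>1\<close>.\<close>

lemma sum_opinion_count_imitate_sq:
  assumes "pair_graph S" "Digraph_Component.connected (with_proj S)"
    and "pair_graph G" "Digraph_Component.connected (with_proj G)"
    and "a \<in> pverts G" "eccentricity G a \<le> \<tau>" "\<eta> \<in> configurations S G"
  shows "(\<Sum>e\<in>parcs S. (real (opinion_count S a (imitate G \<tau> e \<eta>)))\<^sup>2 - (real (opinion_count S a \<eta>))\<^sup>2)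
    \<ge> of_bool (0 < opinion_count S a \<eta> \<and> opinion_count S a \<eta> < card (pverts S))"
proof -
  interpret pair_graph S by fact
  let ?i = "\<lambda>x. of_bool (\<eta> x = a) :: real"
  let ?f = "\<lambda>\<eta>. real (opinion_count S a \<eta>)"
  let ?\<delta> = "\<lambda>e. ?f (imitate G \<tau> e \<eta>) - ?f \<eta>"
  have \<delta>: "?\<delta> e = ?i (snd e) - ?i (fst e)" if "e \<in> parcs S" for e
    using opinion_count_imitate[OF assms(1,3-7), of "fst e" "snd e"] that by simp
  have "(\<Sum>e\<in>parcs S. (?f (imitate G \<tau> e \<eta>))\<^sup>2 - (?f \<eta>)\<^sup>2) = (\<Sum>e\<in>parcs S. 2 * ?f \<eta> * ?\<delta> e + (?\<delta> e)\<^sup>2)"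
    by (intro sum.cong) (auto simp: power2_eq_square algebra_simps)
  also have "\<dots> = 2 * ?f \<eta> * (\<Sum>e\<in>parcs S. ?\<delta> e) + (\<Sum>e\<in>parcs S. (?\<delta> e)\<^sup>2)"
    by (simp add: sum.distrib sum_distrib_left)
  also have "(\<Sum>e\<in>parcs S. ?\<delta> e) = 0"
    by (rule sum_opinion_count_imitate) fact+
  finally have eq: "(\<Sum>e\<in>parcs S. (?f (imitate G \<tau> e \<eta>))\<^sup>2 - (?f \<eta>)\<^sup>2) = (\<Sum>e\<in>parcs S. (?\<delta> e)\<^sup>2)"
    by simp
  show ?thesis
  proof (cases "0 < opinion_count S a \<eta> \<and> opinion_count S a \<eta> < card (pverts S)")
    case True
    then obtain e where e: "e \<in> parcs S" "(\<eta> (fst e) = a) \<noteq> (\<eta> (snd e) = a)"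
      using exists_boundary_arc[OF assms(1,2), of a \<eta>] by fastforce
    then have "1 = (?\<delta> e)\<^sup>2" using \<delta>[OF e(1)] by (auto simp: of_bool_def)
    also have "\<dots> \<le> (\<Sum>e\<in>parcs S. (?\<delta> e)\<^sup>2)"
      using pair_finite_arcs e(1) by (intro member_le_sum) auto
    finally show ?thesis using eq by simp
  next
    case False
    then show ?thesis using eq by (auto simp: sum_nonneg simp del: not_less)
  qed
qed

text \<open>At a count of \<open>0\<close> or \<open>card (pverts S)\<close>, the two ends of every
  arc agree on whether they hold \<open>a\<close>, so these counts are absorbing.\<close>

lemma opinion_count_imitate_extreme:
  assumes "pair_graph S" "pair_graph G" "Digraph_Component.connected (with_proj G)"
    and "a \<in> pverts G" "eccentricity G a \<le> \<tau>" "\<eta> \<in> configurations S G" "e \<in> parcs S"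
    and "\<not> (0 < opinion_count S a \<eta> \<and> opinion_count S a \<eta> < card (pverts S))"
  shows "opinion_count S a (imitate G \<tau> e \<eta>) = opinion_count S a \<eta>"
proof -
  interpret pair_graph S by fact
  have v: "fst e \<in> pverts S" "snd e \<in> pverts S"
    using arc_fst_in_verts arc_snd_in_verts assms(7) by auto
  have "opinion_count S a \<eta> = 0 \<or> opinion_count S a \<eta> = card (pverts S)"
    using assms(8) opinion_count_le[OF assms(1), of a \<eta>] by linarith
  then have "\<eta> (fst e) = a \<longleftrightarrow> \<eta> (snd e) = a"
    using v opinion_count_eq_card_iff[OF assms(1), of a \<eta>] pair_finite_verts
    by (auto simp: opinion_count_def)
  then show ?thesis
    using opinion_count_imitate[OF assms(1-6), of "fst e" "snd e"] assms(7) by simp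
qed

section \<open>Paths between two grid times\<close>

text \<open>Real induction: let \<open>b\<close> be the supremum of the times up to which the path
  is constantly \<open>c\<close>. The left-limit assumption gives the value \<open>c\<close> at
  \<open>b\<close>, and right continuity carries it beyond \<open>b\<close> unless
  \<open>b = t\<close>.\<close>

lemma right_continuous_path_invariant:
  fixes X :: "real \<Rightarrow> 'a"
  assumes "s \<le> t" and start: "X s = c"
    and right: "\<And>u. s \<le> u \<Longrightarrow> u < t \<Longrightarrow> \<forall>\<^sub>F r in at_right u. X r = X u"
    and left: "\<And>u. s < u \<Longrightarrow> u \<le> t \<Longrightarrow> \<exists>\<eta>. (\<forall>\<^sub>F r in at_left u. X r = \<eta>) \<and> (\<eta> = c \<longrightarrow> X u = c)"
  shows "X t = c"
proof -
  define A where "A = {r \<in> {s..t}. \<forall>u\<in>{s..r}. X u = c}"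
  define b where "b = Sup A"
  have sA: "s \<in> A" using assms(1) start by (auto simp: A_def)
  have bdd: "bdd_above A" by (auto simp: A_def intro: bdd_aboveI[of _ t])
  have sb: "s \<le> b" using sA bdd unfolding b_def by (rule cSup_upper)
  have bt: "b \<le> t" unfolding b_def using sA by (intro cSup_least) (auto simp: A_def)
  have below: "X u = c" if u: "s \<le> u" "u < b" for u
  proof -
    obtain r where "r \<in> A" "u < r"
      using u(2) less_cSup_iff[of A u] sA bdd unfolding b_def by auto
    then show ?thesis using u(1) by (auto simp: A_def)
  qed
  have Xb: "X b = c"
  proof (cases "b = s")
    case False
    then have "s < b" using sb by simp
    from left[OF this bt] obtain \<eta> where \<eta>: "\<forall>\<^sub>F r in at_left b. X r = \<eta>" "\<eta> = c \<longrightarrow> X b = c"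
      by blast
    have "\<forall>\<^sub>F r in at_left b. r \<in> {s<..<b}"
      using \<open>s < b\<close> by (rule eventually_at_left_real)
    \<comment> \<open>Just before \<open>b\<close> the path equals both \<open>\<eta>\<close> and
      \<open>c\<close>; the filter \<open>at_left b\<close> is nontrivial, so
      \<open>\<eta> = c\<close>.\<close>
    with \<eta>(1) have "\<forall>\<^sub>F r in at_left b. \<eta> = c"
      by eventually_elim (use below in force)
    then show ?thesis using \<eta>(2) by (simp add: eventually_const)
  qed (use start in simp)
  have "b = t"
  proof (rule ccontr)
    assume "b \<noteq> t"
    then have "b < t" using bt by simp
    from right[OF sb this] obtain d where d: "d > b" "\<And>r. b < r \<Longrightarrow> r < d \<Longrightarrow> X r = X b"
      by (auto simp: eventually_at_right[OF \<open>b < t\<close>])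
    define r where "r = min t ((b + d) / 2)"
    have r: "b < r" "r \<le> t" "r < d" using d(1) \<open>b < t\<close> by (auto simp: r_def min_def field_simps)
    have "X u = c" if "u \<in> {s..r}" for u
      using that below[of u] Xb d(2)[of u] r by (cases u b rule: linorder_cases) auto
    then have "r \<in> A" using r sb by (auto simp: A_def)
    then have "r \<le> b" unfolding b_def using bdd by (rule cSup_upper)
    then show False using r by simp
  qed
  then show ?thesis using Xb by simp
qed

lemma jumps_at_imp_less:
  assumes "mono_on {0..} (\<lambda>t. N t \<omega>)" "jumps_at N \<omega> u" "0 \<le> s" "s < u" "u \<le> t"
  shows "N s \<omega> < N t \<omega>"
proof -
  have "N s \<omega> < N u \<omega>" using assms by (auto simp: jumps_at_def)
  also have "\<dots> \<le> N t \<omega>" using assms by (intro mono_onD[OF assms(1)]) auto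
  finally show ?thesis .
qed

text \<open>The jump time is the infimum \<open>u\<close> of the times at which the count exceeds
  its value at \<open>s\<close>. An increment of one is used up at \<open>u\<close>, which excludes
  a second jump.\<close>

lemma unit_increment_jump:
  fixes N :: "real \<Rightarrow> 'w \<Rightarrow> nat"
  assumes mono: "mono_on {0..} (\<lambda>t. N t \<omega>)"
    and right: "\<And>t. 0 \<le> t \<Longrightarrow> \<forall>\<^sub>F s in at_right t. N s \<omega> = N t \<omega>"
    and st: "0 \<le> s" "s \<le> t" and inc: "N t \<omega> = Suc (N s \<omega>)"
  obtains u where "s < u" "u \<le> t" "jumps_at N \<omega> u"
    "\<And>v. s < v \<Longrightarrow> v \<le> t \<Longrightarrow> jumps_at N \<omega> v \<Longrightarrow> v = u"
proof -
  define A where "A = {r \<in> {s..t}. N s \<omega> < N r \<omega>}"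
  define u where "u = Inf A"
  have tA: "t \<in> A" using st inc by (auto simp: A_def)
  have bdd: "bdd_below A" by (auto simp: A_def intro: bdd_belowI[of _ s])
  have ut: "u \<le> t" unfolding u_def using tA bdd by (rule cInf_lower)
  have su: "s \<le> u" unfolding u_def using tA by (intro cInf_greatest) (auto simp: A_def)
  have below: "N r \<omega> \<le> N s \<omega>" if "0 \<le> r" "r < u" for r
  proof (cases "r \<le> s")
    case True
    then show ?thesis using that st by (intro mono_onD[OF mono]) auto
  next
    case False
    have "r \<notin> A" using that(2) cInf_lower[OF _ bdd, of r] unfolding u_def by auto
    then show ?thesis using False that ut by (auto simp: A_def)
  qed
  \<comment> \<open>Right continuity puts the infimum itself into the set: close to \<open>u\<close>
    there is an element of \<open>A\<close>, and there the count equals that at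
    \<open>u\<close>.\<close>
  have Nu: "N s \<omega> < N u \<omega>"
  proof -
    have "0 \<le> u" using st su by simp
    from right[OF this] obtain d where d: "d > u" "\<And>r. u < r \<Longrightarrow> r < d \<Longrightarrow> N r \<omega> = N u \<omega>"
      by (auto simp: eventually_at_right[of u "u + 1"])
    obtain r where r: "r \<in> A" "r < d"
      using d(1) cInf_less_iff[of A d] tA bdd unfolding u_def by auto
    then have "u \<le> r" unfolding u_def using bdd by (intro cInf_lower) auto
    then have "N r \<omega> = N u \<omega>" using d(2)[of r] r by (cases "r = u") auto
    then show ?thesis using r by (auto simp: A_def)
  qed
  then have "s < u" using su by (cases "s = u") auto
  have Nut: "N u \<omega> = N t \<omega>"
    using Nu inc mono_onD[OF mono, of u t] su ut st by auto
  show thesis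
  proof
    show "s < u" "u \<le> t" by fact+
    show "jumps_at N \<omega> u"
      unfolding jumps_at_def using \<open>s < u\<close> st below Nu by fastforce
    fix v assume v: "s < v" "v \<le> t" "jumps_at N \<omega> v"
    have "\<not> v < u" using jumps_at_imp_less[OF mono v(3) st(1) v(1) order_refl] below[of v] v st by auto
    moreover have "\<not> u < v" using jumps_at_imp_less[OF mono v(3) _ _ v(2), of u] su st Nut by auto
    ultimately show "v = u" by simp
  qed
qed

text \<open>\<open>None\<close> stands both for a slot without activations and for one with several:
  a move is recorded only if exactly one arc is activated, exactly once.\<close>

definition active_arc :: "'e set \<Rightarrow> ('e \<Rightarrow> nat) \<Rightarrow> 'e option" where
  "active_arc E d = (if \<exists>e\<in>E. d e = 1 \<and> (\<forall>e'\<in>E - {e}. d e' = 0)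
     then Some (THE e. e \<in> E \<and> d e = 1) else None)"

lemma active_arc_eq_Some_iff:
  "active_arc E d = Some e \<longleftrightarrow> e \<in> E \<and> d e = 1 \<and> (\<forall>e'\<in>E - {e}. d e' = 0)"
proof -
  have the: "(THE e. e \<in> E \<and> d e = 1) = e'" if e': "e' \<in> E" "d e' = 1" "\<forall>e''\<in>E - {e'}. d e'' = 0" for e'
  proof (rule the_equality)
    show "f = e'" if "f \<in> E \<and> d f = 1" for f
    proof (rule ccontr)
      assume "f \<noteq> e'"
      then have "d f = 0" using that e'(3) by blast
      then show False using that by simp
    qed
  qed (use e' in simp)
  show ?thesis
  proof
    assume "active_arc E d = Some e"
    then obtain e' where "e' \<in> E" "d e' = 1" "\<forall>e''\<in>E - {e'}. d e'' = 0" "e = (THE e. e \<in> E \<and> d e = 1)"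
      unfolding active_arc_def by (auto split: if_splits)
    with the show "e \<in> E \<and> d e = 1 \<and> (\<forall>e'\<in>E - {e}. d e' = 0)" by metis
  next
    assume "e \<in> E \<and> d e = 1 \<and> (\<forall>e'\<in>E - {e}. d e' = 0)"
    then show "active_arc E d = Some e"
      unfolding active_arc_def using the[of e] by auto
  qed
qed

text \<open>Counts outside \<open>E\<close> have no influence, which allows replacing a family by
  its restriction to \<open>E\<close>, as product spaces require.\<close>

lemma active_arc_cong: "(\<And>e. e \<in> E \<Longrightarrow> d e = d' e) \<Longrightarrow> active_arc E d = active_arc E d'"
proof -
  assume "\<And>e. e \<in> E \<Longrightarrow> d e = d' e"
  then have "active_arc E d = Some e \<longleftrightarrow> active_arc E d' = Some e" for e
    by (auto simp: active_arc_eq_Some_iff)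
  then show ?thesis by (metis option.exhaust)
qed

definition imitate_option ::
  "'o pair_pre_digraph \<Rightarrow> nat \<Rightarrow> ('v \<times> 'v) option \<Rightarrow> ('v \<Rightarrow> 'o) \<Rightarrow> ('v \<Rightarrow> 'o)" where
  "imitate_option G \<tau> y \<eta> = (case y of None \<Rightarrow> \<eta> | Some e \<Rightarrow> imitate G \<tau> e \<eta>)"

lemma imitate_option_simps [simp]:
  "imitate_option G \<tau> None \<eta> = \<eta>" "imitate_option G \<tau> (Some e) \<eta> = imitate G \<tau> e \<eta>"
  by (simp_all add: imitate_option_def)

text \<open>By \<open>le1\<close> and \<open>single\<close> the slot contains at most one jump, at
  some time \<open>u\<close>. The path stands still before \<open>u\<close>, so its left limit there
  is the state at \<open>s\<close>; \<open>dyn\<close> then performs the imitation, and the path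
  stands still again up to \<open>t\<close>.\<close>

lemma path_step:
  fixes N :: "'v \<times> 'v \<Rightarrow> real \<Rightarrow> 'w \<Rightarrow> nat"
  assumes right: "\<And>t. 0 \<le> t \<Longrightarrow> \<forall>\<^sub>F s in at_right t. \<xi> s \<omega> = \<xi> t \<omega>"
    and mono: "\<And>e. e \<in> E \<Longrightarrow> mono_on {0..} (\<lambda>t. N e t \<omega>)"
    and rightN: "\<And>e t. e \<in> E \<Longrightarrow> 0 \<le> t \<Longrightarrow> \<forall>\<^sub>F s in at_right t. N e s \<omega> = N e t \<omega>"
    and dyn: "\<And>t. 0 < t \<Longrightarrow> \<exists>\<eta>. (\<forall>\<^sub>F s in at_left t. \<xi> s \<omega> = \<eta>) \<and>
         (\<forall>e\<in>E. jumps_at (N e) \<omega> t \<longrightarrow> \<xi> t \<omega> = imitate G \<tau> e \<eta>) \<and>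
         ((\<forall>e\<in>E. \<not> jumps_at (N e) \<omega> t) \<longrightarrow> \<xi> t \<omega> = \<eta>)"
    and st: "0 \<le> s" "s \<le> t"
    and le1: "\<And>e. e \<in> E \<Longrightarrow> N e t \<omega> - N e s \<omega> \<le> 1"
    and single: "\<And>e e'. e \<in> E \<Longrightarrow> e' \<in> E \<Longrightarrow> e \<noteq> e' \<Longrightarrow>
      N e t \<omega> - N e s \<omega> = 0 \<or> N e' t \<omega> - N e' s \<omega> = 0"
  shows "\<xi> t \<omega> = imitate_option G \<tau> (active_arc E (\<lambda>e. N e t \<omega> - N e s \<omega>)) (\<xi> s \<omega>)"
proof -
  have still: "\<xi> r \<omega> = \<xi> q \<omega>"
    if "0 \<le> q" "q \<le> r" and nj: "\<And>u e. q < u \<Longrightarrow> u \<le> r \<Longrightarrow> e \<in> E \<Longrightarrow> \<not> jumps_at (N e) \<omega> u" for q r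
  proof (rule right_continuous_path_invariant[where X = "\<lambda>t. \<xi> t \<omega>"])
    fix u assume u: "q < u" "u \<le> r"
    then show "\<exists>\<eta>. (\<forall>\<^sub>F r in at_left u. \<xi> r \<omega> = \<eta>) \<and> (\<eta> = \<xi> q \<omega> \<longrightarrow> \<xi> u \<omega> = \<xi> q \<omega>)"
      using dyn[of u] nj[OF u] that(1) by fastforce
  qed (use that right in auto)
  \<comment> \<open>A jump in the slot would force \<open>N e s \<omega> < N e t \<omega>\<close>,
    whereas a zero difference of naturals means
    \<open>N e t \<omega> \<le> N e s \<omega>\<close>.\<close>
  have nojump: "\<not> jumps_at (N e) \<omega> u"
    if "e \<in> E" "N e t \<omega> - N e s \<omega> = 0" "s < u" "u \<le> t" for e u
    using jumps_at_imp_less[where N = "N e", OF mono[OF that(1)] _ st(1) that(3,4)] that(2) by auto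
  show ?thesis
  proof (cases "\<exists>e\<in>E. N e t \<omega> - N e s \<omega> = 1")
    case False
    then have zero: "N e t \<omega> - N e s \<omega> = 0" if "e \<in> E" for e
      using le1[OF that] that by force
    have "active_arc E (\<lambda>e. N e t \<omega> - N e s \<omega>) = None"
      using False by (auto simp: active_arc_def)
    moreover have "\<xi> t \<omega> = \<xi> s \<omega>"
      using st nojump zero by (intro still) auto
    ultimately show ?thesis by simp
  next
    case True
    then obtain e where e: "e \<in> E" "N e t \<omega> - N e s \<omega> = 1" by blast
    then have others: "N e' t \<omega> - N e' s \<omega> = 0" if "e' \<in> E" "e' \<noteq> e" for e'
      using single[OF that(1) e(1) that(2)] by simp
    have act: "active_arc E (\<lambda>e. N e t \<omega> - N e s \<omega>) = Some e"
      using e others by (auto simp: active_arc_eq_Some_iff)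
    have inc: "N e t \<omega> = Suc (N e s \<omega>)" using e(2) by simp
    obtain u where u: "s < u" "u \<le> t" "jumps_at (N e) \<omega> u"
      and uniq: "\<And>v. s < v \<Longrightarrow> v \<le> t \<Longrightarrow> jumps_at (N e) \<omega> v \<Longrightarrow> v = u"
      using unit_increment_jump[where N = "N e", OF mono[OF e(1)] rightN[OF e(1)] st inc] by metis
    have only: "v = u" if "s < v" "v \<le> t" "e' \<in> E" "jumps_at (N e') \<omega> v" for v e'
      using that uniq nojump[of e' v] others[of e'] by (cases "e' = e") auto
    have before: "\<xi> r \<omega> = \<xi> s \<omega>" if "s \<le> r" "r < u" for r
    proof (rule still)
      show "\<not> jumps_at (N e') \<omega> v" if "s < v" "v \<le> r" "e' \<in> E" for v e'
        using only[of v e'] that \<open>r < u\<close> u(2) by auto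
    qed (use that st in auto)
    have "0 < u" using u st by simp
    from dyn[OF this] obtain \<eta> where \<eta>: "\<forall>\<^sub>F r in at_left u. \<xi> r \<omega> = \<eta>" "\<xi> u \<omega> = imitate G \<tau> e \<eta>"
      using e(1) u(3) by blast
    have "\<forall>\<^sub>F r in at_left u. r \<in> {s<..<u}"
      using u(1) by (rule eventually_at_left_real)
    with \<eta>(1) have "\<forall>\<^sub>F r in at_left u. \<eta> = \<xi> s \<omega>"
      by eventually_elim (metis before greaterThanLessThan_iff less_imp_le)
    then have "\<eta> = \<xi> s \<omega>" by (simp add: eventually_const)
    moreover have "\<xi> t \<omega> = \<xi> u \<omega>"
    proof (rule still)
      show "\<not> jumps_at (N e') \<omega> v" if "u < v" "v \<le> t" "e' \<in> E" for v e'
        using only[of v e'] that u(1) by auto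
    qed (use u st in auto)
    ultimately show ?thesis using \<eta>(2) act by simp
  qed
qed

section \<open>Chains driven by independent moves\<close>

lemma (in prob_space) prob_eq_sum_finite_range:
  assumes "X \<in> M \<rightarrow>\<^sub>M count_space K" "finite K" "A \<in> events"
  shows "prob A = (\<Sum>x\<in>K. prob {\<omega> \<in> space M. \<omega> \<in> A \<and> X \<omega> = x})"
proof -
  have X: "X \<omega> \<in> K" if "\<omega> \<in> space M" for \<omega>
    using measurable_space[OF assms(1) that] by simp
  have "A = (\<Union>x\<in>K. {\<omega> \<in> space M. \<omega> \<in> A \<and> X \<omega> = x})"
    using X sets.sets_into_space[OF assms(3)] by auto
  moreover have "{\<omega> \<in> space M. \<omega> \<in> A \<and> X \<omega> = x} \<in> events" if "x \<in> K" for x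
  proof -
    have "{\<omega> \<in> space M. \<omega> \<in> A \<and> X \<omega> = x} = A \<inter> (X -` {x} \<inter> space M)"
      using sets.sets_into_space[OF assms(3)] by auto
    then show ?thesis using measurable_sets[OF assms(1), of "{x}"] that assms(3) by auto
  qed
  ultimately show ?thesis
    using finite_measure_finite_Union[OF assms(2), of "\<lambda>x. {\<omega> \<in> space M. \<omega> \<in> A \<and> X \<omega> = x}"]
    by (auto simp: disjoint_family_on_def)
qed

lemma (in prob_space) expectation_finite_range:
  fixes g :: "'b \<Rightarrow> real"
  assumes "X \<in> M \<rightarrow>\<^sub>M count_space K" "finite K"
  shows "expectation (\<lambda>\<omega>. g (X \<omega>)) = (\<Sum>x\<in>K. prob {\<omega> \<in> space M. X \<omega> = x} * g x)"
proof -
  have X: "X \<omega> \<in> K" if "\<omega> \<in> space M" for \<omega>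
    using measurable_space[OF assms(1) that] by simp
  have ev: "{\<omega> \<in> space M. X \<omega> = x} \<in> events" if "x \<in> K" for x
  proof -
    have "{\<omega> \<in> space M. X \<omega> = x} = X -` {x} \<inter> space M" by auto
    then show ?thesis using measurable_sets[OF assms(1), of "{x}"] that by auto
  qed
  have "expectation (\<lambda>\<omega>. g (X \<omega>))
    = expectation (\<lambda>\<omega>. \<Sum>x\<in>K. indicator {\<omega> \<in> space M. X \<omega> = x} \<omega> * g x)"
  proof (intro Bochner_Integration.integral_cong refl)
    fix \<omega> assume \<omega>: "\<omega> \<in> space M"
    have "(\<Sum>x\<in>K. indicator {\<omega> \<in> space M. X \<omega> = x} \<omega> * g x) = (\<Sum>x\<in>K. if X \<omega> = x then g x else 0)"
      using \<omega> by (intro sum.cong) (auto simp: indicator_def)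
    then show "g (X \<omega>) = (\<Sum>x\<in>K. indicator {\<omega> \<in> space M. X \<omega> = x} \<omega> * g x)"
      using X[OF \<omega>] assms(2) by simp
  qed
  also have "\<dots> = (\<Sum>x\<in>K. expectation (\<lambda>\<omega>. indicator {\<omega> \<in> space M. X \<omega> = x} \<omega> * g x))"
    using ev by (intro Bochner_Integration.integral_sum integrable_mult_left) (auto simp: emeasure_eq_measure)
  also have "\<dots> = (\<Sum>x\<in>K. prob {\<omega> \<in> space M. X \<omega> = x} * g x)"
    using ev by (intro sum.cong) (auto simp: sets.Int_space_eq2)
  finally show ?thesis .
qed

text \<open>Everything takes finitely many values, so independence is expressed by point
  probabilities. That \<open>p\<close> is the same for all \<open>e\<close> and all times lets the
  symmetry of the arcs pass to expectations; the remaining probability goes to \<open>None\<close>,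
  standing still.\<close>

locale driven_chain = prob_space M for M :: "'w measure" +
  fixes K :: "'s set" and E :: "'e set" and Z :: "nat \<Rightarrow> 'w \<Rightarrow> 's" and Y :: "nat \<Rightarrow> 'w \<Rightarrow> 'e option"
    and move :: "'e \<Rightarrow> 's \<Rightarrow> 's" and p :: real
  assumes finite_K: "finite K" and finite_E: "finite E"
    and Z0: "Z 0 \<in> M \<rightarrow>\<^sub>M count_space K"
    and Y: "Y k \<in> M \<rightarrow>\<^sub>M count_space (insert None (Some ` E))"
    and Z_Suc: "\<omega> \<in> space M \<Longrightarrow> Z (Suc k) \<omega> = (case Y k \<omega> of None \<Rightarrow> Z k \<omega> | Some e \<Rightarrow> move e (Z k \<omega>))"
    and move: "e \<in> E \<Longrightarrow> z \<in> K \<Longrightarrow> move e z \<in> K"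
    and indep: "z \<in> K \<Longrightarrow> (\<And>j. y j \<in> insert None (Some ` E)) \<Longrightarrow>
      prob {\<omega> \<in> space M. Z 0 \<omega> = z \<and> (\<forall>j<n. Y j \<omega> = y j)}
        = prob {\<omega> \<in> space M. Z 0 \<omega> = z} * (\<Prod>j<n. prob {\<omega> \<in> space M. Y j \<omega> = y j})"
    and p: "e \<in> E \<Longrightarrow> prob {\<omega> \<in> space M. Y k \<omega> = Some e} = p"
begin

abbreviation "moves \<equiv> insert None (Some ` E)"

definition "step y z = (case y of None \<Rightarrow> z | Some e \<Rightarrow> move e z)"

lemma step_in: "y \<in> moves \<Longrightarrow> z \<in> K \<Longrightarrow> step y z \<in> K"
  using move by (auto simp: step_def)

lemma finite_moves: "finite moves"
  using finite_E by simp

lemma Z_measurable: "Z k \<in> M \<rightarrow>\<^sub>M count_space K"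
proof (induction k)
  case (Suc k)
  have "(\<lambda>\<omega>. (Y k \<omega>, Z k \<omega>)) \<in> M \<rightarrow>\<^sub>M count_space moves \<Otimes>\<^sub>M count_space K"
    using Y Suc by (rule measurable_Pair)
  then have "(\<lambda>\<omega>. (Y k \<omega>, Z k \<omega>)) \<in> M \<rightarrow>\<^sub>M count_space (moves \<times> K)"
    using finite_K finite_moves by (simp add: pair_measure_countable countable_finite)
  then have "(\<lambda>\<omega>. case (Y k \<omega>, Z k \<omega>) of (y, z) \<Rightarrow> step y z) \<in> M \<rightarrow>\<^sub>M count_space K"
    by (rule measurable_compose) (use step_in in auto)
  then show ?case
    by (subst measurable_cong[where g = "\<lambda>\<omega>. step (Y k \<omega>) (Z k \<omega>)"]) (auto simp: Z_Suc step_def)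
qed (rule Z0)

lemma Z_event: "{\<omega> \<in> space M. Z k \<omega> = z} \<in> events"
proof (cases "z \<in> K")
  case True
  have "{\<omega> \<in> space M. Z k \<omega> = z} = Z k -` {z} \<inter> space M" by auto
  then show ?thesis using measurable_sets[OF Z_measurable, of "{z}" k] True by auto
next
  case False
  then have "{\<omega> \<in> space M. Z k \<omega> = z} = {}" using measurable_space[OF Z_measurable] by auto
  then show ?thesis by (metis sets.empty_sets)
qed

lemma Y_event: "{\<omega> \<in> space M. Y k \<omega> = y} \<in> events"
proof (cases "y \<in> moves")
  case True
  have "{\<omega> \<in> space M. Y k \<omega> = y} = Y k -` {y} \<inter> space M" by auto
  then show ?thesis using measurable_sets[OF Y, of "{y}" k] True by auto
next
  case False
  then have "{\<omega> \<in> space M. Y k \<omega> = y} = {}" using measurable_space[OF Y, of _ k] by fastforce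
  then show ?thesis by (metis sets.empty_sets)
qed

text \<open>State and move at time \<open>k\<close> determine the next state, so each cell of the
  partition by these two either has the required next state throughout or nowhere. The spectator
  event \<open>A\<close> will be about later moves.\<close>

lemma prob_Z_Suc:
  assumes A: "A \<in> events"
  shows "prob {\<omega> \<in> space M. Z (Suc k) \<omega> = z \<and> \<omega> \<in> A}
    = (\<Sum>z'\<in>K. \<Sum>y\<in>moves. of_bool (step y z' = z) * prob {\<omega> \<in> space M. Z k \<omega> = z' \<and> Y k \<omega> = y \<and> \<omega> \<in> A})"
proof -
  let ?B = "{\<omega> \<in> space M. Z (Suc k) \<omega> = z \<and> \<omega> \<in> A}"
  have B: "?B \<in> events"
    using sets.Int[OF Z_event[of "Suc k" z] A] by (simp add: Collect_conj_eq Int_assoc)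
  have C: "{\<omega> \<in> space M. \<omega> \<in> ?B \<and> Z k \<omega> = z'} \<in> events" for z'
    using sets.Int[OF B Z_event[of k z']] by (auto simp: Int_def conj_ac)
  have "prob ?B = (\<Sum>z'\<in>K. prob {\<omega> \<in> space M. \<omega> \<in> ?B \<and> Z k \<omega> = z'})"
    by (rule prob_eq_sum_finite_range[OF Z_measurable finite_K B])
  also have "\<dots> = (\<Sum>z'\<in>K. \<Sum>y\<in>moves. prob {\<omega> \<in> space M. \<omega> \<in> {\<omega> \<in> space M. \<omega> \<in> ?B \<and> Z k \<omega> = z'} \<and> Y k \<omega> = y})"
    by (intro sum.cong refl prob_eq_sum_finite_range[OF Y finite_moves] C)
  also have "\<dots> = (\<Sum>z'\<in>K. \<Sum>y\<in>moves. of_bool (step y z' = z) * prob {\<omega> \<in> space M. Z k \<omega> = z' \<and> Y k \<omega> = y \<and> \<omega> \<in> A})"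
  proof (intro sum.cong refl)
    fix z' y
    have "{\<omega> \<in> space M. \<omega> \<in> {\<omega> \<in> space M. \<omega> \<in> ?B \<and> Z k \<omega> = z'} \<and> Y k \<omega> = y}
      = (if step y z' = z then {\<omega> \<in> space M. Z k \<omega> = z' \<and> Y k \<omega> = y \<and> \<omega> \<in> A} else {})"
      by (auto simp: Z_Suc step_def split: option.splits)
    then show "prob {\<omega> \<in> space M. \<omega> \<in> {\<omega> \<in> space M. \<omega> \<in> ?B \<and> Z k \<omega> = z'} \<and> Y k \<omega> = y}
      = of_bool (step y z' = z) * prob {\<omega> \<in> space M. Z k \<omega> = z' \<and> Y k \<omega> = y \<and> \<omega> \<in> A}"
      by simp
  qed
  finally show ?thesis .
qed

text \<open>The state at time \<open>k\<close> is a function of the initial state and of the moves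
  before \<open>k\<close>, hence independent of the moves from \<open>k\<close> on. The induction on
  \<open>k\<close> keeps \<open>z\<close>, \<open>y\<close> and \<open>m\<close> general.\<close>

lemma prob_Z_and_later_moves:
  assumes "z \<in> K" "\<And>j. y j \<in> moves"
  shows "prob {\<omega> \<in> space M. Z k \<omega> = z \<and> (\<forall>j\<in>{k..<k+m}. Y j \<omega> = y j)}
    = prob {\<omega> \<in> space M. Z k \<omega> = z} * (\<Prod>j\<in>{k..<k+m}. prob {\<omega> \<in> space M. Y j \<omega> = y j})"
  using assms
proof (induction k arbitrary: z y m)
  case 0
  then show ?case using indep[of z y m] by (simp add: atLeast0LessThan lessThan_def)
next
  case (Suc k)
  let ?A = "{\<omega> \<in> space M. \<forall>j\<in>{Suc k..<Suc k+m}. Y j \<omega> = y j}"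
  let ?r = "\<Prod>j\<in>{Suc k..<Suc k+m}. prob {\<omega> \<in> space M. Y j \<omega> = y j}"
  have A: "?A \<in> events"
    by (rule sets.sets_Collect_finite_All) (auto intro: Y_event)
  have one: "prob {\<omega> \<in> space M. Z k \<omega> = z' \<and> Y k \<omega> = y'} =
    prob {\<omega> \<in> space M. Z k \<omega> = z'} * prob {\<omega> \<in> space M. Y k \<omega> = y'}"
    if "z' \<in> K" "y' \<in> moves" for z' y'
    using Suc.IH[OF that(1), of "\<lambda>_. y'" 1] that(2) by simp
  have later: "prob {\<omega> \<in> space M. Z k \<omega> = z' \<and> Y k \<omega> = y' \<and> \<omega> \<in> ?A}
    = prob {\<omega> \<in> space M. Z k \<omega> = z' \<and> Y k \<omega> = y'} * ?r"
    if zy: "z' \<in> K" "y' \<in> moves" for z' y'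
  proof -
    \<comment> \<open>Prescribing the move at \<open>k\<close> as well adds one slot in front, so
      the induction hypothesis is used with \<open>Suc m\<close> moves and with \<open>y\<close>
      altered at \<open>k\<close>.\<close>
    have iv: "{k..<k + Suc m} = insert k {Suc k..<Suc k+m}" by auto
    have "{\<omega> \<in> space M. Z k \<omega> = z' \<and> Y k \<omega> = y' \<and> \<omega> \<in> ?A}
      = {\<omega> \<in> space M. Z k \<omega> = z' \<and> (\<forall>j\<in>{k..<k + Suc m}. Y j \<omega> = (y(k := y')) j)}"
      unfolding iv by auto
    also have "prob \<dots> = prob {\<omega> \<in> space M. Z k \<omega> = z'}
       * (\<Prod>j\<in>{k..<k + Suc m}. prob {\<omega> \<in> space M. Y j \<omega> = (y(k := y')) j})"
      using zy Suc.prems by (intro Suc.IH) auto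
    also have "(\<Prod>j\<in>{k..<k + Suc m}. prob {\<omega> \<in> space M. Y j \<omega> = (y(k := y')) j})
      = prob {\<omega> \<in> space M. Y k \<omega> = y'} * ?r"
      unfolding iv by (subst prod.insert) (auto intro!: prod.cong)
    finally show ?thesis using one[OF zy] by simp
  qed
  have "prob {\<omega> \<in> space M. Z (Suc k) \<omega> = z \<and> (\<forall>j\<in>{Suc k..<Suc k+m}. Y j \<omega> = y j)}
    = prob {\<omega> \<in> space M. Z (Suc k) \<omega> = z \<and> \<omega> \<in> ?A}"
    by (rule arg_cong[where f = prob]) auto
  also have "\<dots> = (\<Sum>z'\<in>K. \<Sum>y\<in>moves. of_bool (step y z' = z) * (prob {\<omega> \<in> space M. Z k \<omega> = z' \<and> Y k \<omega> = y} * ?r))"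
    unfolding prob_Z_Suc[OF A] by (intro sum.cong refl arg_cong2[where f = "(*)"] later)
  \<comment> \<open>The factor \<open>?r\<close> is common to all terms; what remains is
    \<open>prob_Z_Suc\<close> for the sure event, to be read backwards.\<close>
  also have "\<dots> = (\<Sum>z'\<in>K. \<Sum>y\<in>moves. of_bool (step y z' = z) *
       prob {\<omega> \<in> space M. Z k \<omega> = z' \<and> Y k \<omega> = y \<and> \<omega> \<in> space M}) * ?r"
    unfolding sum_distrib_right by (intro sum.cong refl) (auto simp: conj_ac)
  also have "\<dots> = prob {\<omega> \<in> space M. Z (Suc k) \<omega> = z} * ?r"
    unfolding prob_Z_Suc[OF sets.top, symmetric] by (simp add: conj_ac)
  finally show ?case .
qed

lemma prob_Z_Y:
  assumes "z \<in> K" "y \<in> moves"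
  shows "prob {\<omega> \<in> space M. Z k \<omega> = z \<and> Y k \<omega> = y}
    = prob {\<omega> \<in> space M. Z k \<omega> = z} * prob {\<omega> \<in> space M. Y k \<omega> = y}"
  using prob_Z_and_later_moves[OF assms(1), of "\<lambda>_. y" k 1] assms(2) by simp

text \<open>The discrete generator: state and move at time \<open>k\<close> are independent,
  \<open>None\<close> contributes no change, and all arcs share the weight \<open>p\<close>. The
  mean drift is a finite sum over \<open>K\<close>, so the drift has to be known on \<open>K\<close>
  only.\<close>

lemma expectation_Z_Suc:
  fixes g :: "'s \<Rightarrow> real"
  shows "expectation (\<lambda>\<omega>. g (Z (Suc k) \<omega>)) = expectation (\<lambda>\<omega>. g (Z k \<omega>))
    + p * (\<Sum>z\<in>K. prob {\<omega> \<in> space M. Z k \<omega> = z} * (\<Sum>e\<in>E. g (move e z) - g z))"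
proof -
  let ?P = "\<lambda>z. prob {\<omega> \<in> space M. Z k \<omega> = z}" and ?q = "\<lambda>y. prob {\<omega> \<in> space M. Y k \<omega> = y}"
  have YZ: "(\<lambda>\<omega>. (Z k \<omega>, Y k \<omega>)) \<in> M \<rightarrow>\<^sub>M count_space (K \<times> moves)"
    using measurable_Pair[OF Z_measurable Y, of k k] finite_K finite_moves
    by (simp add: pair_measure_countable countable_finite)
  have "expectation (\<lambda>\<omega>. g (Z (Suc k) \<omega>) - g (Z k \<omega>))
    = expectation (\<lambda>\<omega>. (\<lambda>(z, y). g (step y z) - g z) (Z k \<omega>, Y k \<omega>))"
    by (intro Bochner_Integration.integral_cong) (auto simp: Z_Suc step_def)
  also have "\<dots> = (\<Sum>zy\<in>K \<times> moves. prob {\<omega> \<in> space M. (Z k \<omega>, Y k \<omega>) = zy} * (\<lambda>(z, y). g (step y z) - g z) zy)"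
    using finite_K finite_moves by (intro expectation_finite_range[OF YZ]) auto
  also have "\<dots> = (\<Sum>z\<in>K. \<Sum>y\<in>moves. prob {\<omega> \<in> space M. Z k \<omega> = z \<and> Y k \<omega> = y} * (g (step y z) - g z))"
    by (simp add: sum.cartesian_product case_prod_unfold prod_eq_iff)
  also have "\<dots> = (\<Sum>z\<in>K. \<Sum>y\<in>moves. ?P z * ?q y * (g (step y z) - g z))"
    by (intro sum.cong refl arg_cong2[where f = "(*)"] prob_Z_Y)
  also have "\<dots> = (\<Sum>z\<in>K. ?P z * (p * (\<Sum>e\<in>E. g (move e z) - g z)))"
  proof (intro sum.cong refl)
    fix z
    have "(\<Sum>y\<in>moves. ?P z * ?q y * (g (step y z) - g z))
      = (\<Sum>y\<in>Some ` E. ?P z * ?q y * (g (step y z) - g z))"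
      using finite_E by (subst sum.insert) (auto simp: step_def)
    also have "\<dots> = (\<Sum>e\<in>E. ?P z * ?q (Some e) * (g (move e z) - g z))"
      by (subst sum.reindex) (auto simp: step_def)
    also have "\<dots> = ?P z * (p * (\<Sum>e\<in>E. g (move e z) - g z))"
      by (simp add: sum_distrib_left p mult.assoc)
    finally show "(\<Sum>y\<in>moves. ?P z * ?q y * (g (step y z) - g z))
      = ?P z * (p * (\<Sum>e\<in>E. g (move e z) - g z))" .
  qed
  also have "\<dots> = p * (\<Sum>z\<in>K. ?P z * (\<Sum>e\<in>E. g (move e z) - g z))"
    unfolding sum_distrib_left[of p _ K] by (intro sum.cong refl mult.left_commute)
  finally have *: "expectation (\<lambda>\<omega>. g (Z (Suc k) \<omega>) - g (Z k \<omega>))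
    = p * (\<Sum>z\<in>K. ?P z * (\<Sum>e\<in>E. g (move e z) - g z))" .
  have int: "integrable M (\<lambda>\<omega>. g (Z j \<omega>))" for j
  proof (rule integrable_const_bound)
    show "AE \<omega> in M. norm (g (Z j \<omega>)) \<le> (\<Sum>z\<in>K. norm (g z))"
      using measurable_space[OF Z_measurable, of _ j] finite_K
      by (intro AE_I2 member_le_sum) auto
    show "(\<lambda>\<omega>. g (Z j \<omega>)) \<in> borel_measurable M"
      using Z_measurable by (rule measurable_compose) auto
  qed
  show ?thesis using * by (simp add: Bochner_Integration.integral_diff[OF int int])
qed

lemma expectation_martingale:
  fixes f :: "'s \<Rightarrow> real"
  assumes "\<And>z. z \<in> K \<Longrightarrow> (\<Sum>e\<in>E. f (move e z) - f z) = 0"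
  shows "expectation (\<lambda>\<omega>. f (Z k \<omega>)) = expectation (\<lambda>\<omega>. f (Z 0 \<omega>))"
  by (induction k) (simp_all add: expectation_Z_Suc assms)

text \<open>The mean of \<open>f\<close> squared grows in each step by at least \<open>p\<close>
  times the probability of being in \<open>B\<close>. This probability decreases in time because the
  complement of \<open>B\<close> is absorbing, so \<open>n\<close> steps gain at least
  \<open>n * p\<close> times its final value, while the mean stays below
  \<open>c\<^sup>2\<close>.\<close>

lemma prob_not_absorbed_le:
  fixes f :: "'s \<Rightarrow> real"
  assumes "0 \<le> p"
    and drift: "\<And>z. z \<in> K \<Longrightarrow> of_bool (z \<in> B) \<le> (\<Sum>e\<in>E. (f (move e z))\<^sup>2 - (f z)\<^sup>2)"
    and absorb: "\<And>z e. z \<in> K \<Longrightarrow> z \<notin> B \<Longrightarrow> e \<in> E \<Longrightarrow> move e z \<notin> B"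
    and bound: "\<And>z. z \<in> K \<Longrightarrow> 0 \<le> f z \<and> f z \<le> c"
  shows "n * p * prob {\<omega> \<in> space M. Z n \<omega> \<in> B} \<le> c\<^sup>2"
proof -
  let ?B = "\<lambda>k. {\<omega> \<in> space M. Z k \<omega> \<in> B}"
  have Bev: "?B k \<in> events" for k
  proof -
    have "?B k = (\<Union>z\<in>K \<inter> B. {\<omega> \<in> space M. Z k \<omega> = z})"
      using measurable_space[OF Z_measurable, of _ k] by auto
    then show ?thesis using Z_event finite_K by auto
  qed
  have dec: "prob (?B (Suc k)) \<le> prob (?B k)" for k
  proof (rule finite_measure_mono)
    show "?B (Suc k) \<subseteq> ?B k"
    proof safe
      fix \<omega> assume \<omega>: "\<omega> \<in> space M" "Z (Suc k) \<omega> \<in> B"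
      have "Z k \<omega> \<in> K" "Y k \<omega> \<in> moves"
        using measurable_space[OF Z_measurable \<omega>(1), of k] measurable_space[OF Y \<omega>(1), of k] by auto
      then show "Z k \<omega> \<in> B"
        using \<omega> absorb by (auto simp: Z_Suc split: option.splits)
    qed
  qed (rule Bev)
  have anti: "prob (?B n) \<le> prob (?B k)" if "k \<le> n" for k
    using that by (induction n rule: dec_induct) (auto intro: order_trans[OF dec])
  \<comment> \<open>The probability at the final time \<open>n\<close> serves as a lower bound in
    every step; at \<open>k = 0\<close> the claim is that the mean is nonnegative.\<close>
  have "expectation (\<lambda>\<omega>. (f (Z k \<omega>))\<^sup>2) \<ge> k * p * prob (?B n)" if "k \<le> n" for k
    using that
  proof (induction k)
    case (Suc k)
    have "prob (?B k) = expectation (\<lambda>\<omega>. of_bool (Z k \<omega> \<in> B))"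
    proof -
      have "expectation (\<lambda>\<omega>. of_bool (Z k \<omega> \<in> B)) = expectation (indicator (?B k))"
        by (intro Bochner_Integration.integral_cong) (auto simp: indicator_def)
      also have "\<dots> = prob (?B k)"
        using Bochner_Integration.integral_indicator[of M "?B k"] sets.Int_space_eq2[OF Bev] by simp
      finally show ?thesis ..
    qed
    also have "\<dots> = (\<Sum>z\<in>K. prob {\<omega> \<in> space M. Z k \<omega> = z} * of_bool (z \<in> B))"
      by (rule expectation_finite_range[OF Z_measurable finite_K])
    also have "\<dots> \<le> (\<Sum>z\<in>K. prob {\<omega> \<in> space M. Z k \<omega> = z} * (\<Sum>e\<in>E. (f (move e z))\<^sup>2 - (f z)\<^sup>2))"
      using drift by (intro sum_mono mult_left_mono) auto
    finally have "p * prob (?B n) \<le> p * (\<Sum>z\<in>K. prob {\<omega> \<in> space M. Z k \<omega> = z} * (\<Sum>e\<in>E. (f (move e z))\<^sup>2 - (f z)\<^sup>2))"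
      using anti[of k] Suc.prems \<open>0 \<le> p\<close> by (intro mult_left_mono) auto
    then show ?case
      using Suc expectation_Z_Suc[of "\<lambda>z. (f z)\<^sup>2" k] by (simp add: algebra_simps)
  qed simp
  from this[of n] have "n * p * prob (?B n) \<le> expectation (\<lambda>\<omega>. (f (Z n \<omega>))\<^sup>2)" by simp
  also have "\<dots> = (\<Sum>z\<in>K. prob {\<omega> \<in> space M. Z n \<omega> = z} * (f z)\<^sup>2)"
    by (rule expectation_finite_range[OF Z_measurable finite_K])
  also have "\<dots> \<le> (\<Sum>z\<in>K. prob {\<omega> \<in> space M. Z n \<omega> = z} * c\<^sup>2)"
    using bound by (intro sum_mono mult_left_mono power_mono) auto
  also have "\<dots> = c\<^sup>2"
    using expectation_finite_range[OF Z_measurable finite_K, of "\<lambda>_. c\<^sup>2" n] by (simp add: prob_space)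
  finally show ?thesis .
qed

end

section \<open>Increments of the activation counts\<close>

text \<open>Finitely many natural-valued coordinates form a discrete product space, on which every
  map is measurable.\<close>

lemma measurable_active_arc:
  assumes "finite E" "\<And>e. e \<in> E \<Longrightarrow> D e \<in> M \<rightarrow>\<^sub>M count_space UNIV"
  shows "(\<lambda>\<omega>. active_arc E (\<lambda>e. D e \<omega>)) \<in> M \<rightarrow>\<^sub>M count_space (insert None (Some ` E))"
proof -
  have "(\<lambda>\<omega>. \<lambda>e\<in>E. D e \<omega>) \<in> M \<rightarrow>\<^sub>M (\<Pi>\<^sub>M e\<in>E. count_space UNIV)"
    using assms(2) by (rule measurable_restrict)
  also have "(\<Pi>\<^sub>M e\<in>E. count_space UNIV) = count_space (E \<rightarrow>\<^sub>E (UNIV :: nat set))"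
    using assms(1) by (intro count_space_PiM_finite) auto
  finally have "(\<lambda>\<omega>. active_arc E (\<lambda>e\<in>E. D e \<omega>)) \<in> M \<rightarrow>\<^sub>M count_space (insert None (Some ` E))"
  proof (rule measurable_compose)
    have "active_arc E d \<in> insert None (Some ` E)" for d
      by (cases "active_arc E d") (auto simp: active_arc_eq_Some_iff)
    then show "active_arc E \<in> count_space (E \<rightarrow>\<^sub>E (UNIV :: nat set)) \<rightarrow>\<^sub>M count_space (insert None (Some ` E))"
      by auto
  qed
  moreover have "active_arc E (\<lambda>e\<in>E. D e \<omega>) = active_arc E (\<lambda>e. D e \<omega>)" for \<omega>
    by (rule active_arc_cong) simp
  ultimately show ?thesis by simp
qed

lemma measurable_diff_nat:
  fixes f g :: "'a \<Rightarrow> nat"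
  assumes [measurable]: "f \<in> M \<rightarrow>\<^sub>M count_space UNIV" "g \<in> M \<rightarrow>\<^sub>M count_space UNIV"
  shows "(\<lambda>x. f x - g x) \<in> M \<rightarrow>\<^sub>M count_space UNIV"
  by measurable

text \<open>The probability is \<open>1 - exp (- h)\<close>, and
  \<open>exp (- h) \<ge> 1 - h\<close>.\<close>

lemma poisson_pmf_prob_ge_1: "0 < h \<Longrightarrow> measure_pmf.prob (poisson_pmf h) {1..} \<le> h"
proof -
  assume h: "0 < h"
  have "measure_pmf.prob (poisson_pmf h) {1..} = 1 - measure_pmf.prob (poisson_pmf h) {0}"
    by (subst measure_pmf.prob_compl[symmetric]) (auto intro!: arg_cong[where f = "measure_pmf.prob _"])
  also have "measure_pmf.prob (poisson_pmf h) {0} = exp (- h)"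
    using h by (simp add: measure_pmf_single)
  finally show ?thesis using exp_ge_add_one_self[of "- h"] by simp
qed

text \<open>The same exponential bound gives
  \<open>1 - (1 + h) * exp (- h) \<le> 1 - (1 + h) * (1 - h)\<close>, where the terms linear in
  \<open>h\<close> cancel.\<close>

lemma poisson_pmf_prob_ge_2: "0 < h \<Longrightarrow> measure_pmf.prob (poisson_pmf h) {2..} \<le> h\<^sup>2"
proof -
  assume h: "0 < h"
  have "measure_pmf.prob (poisson_pmf h) {2..} = 1 - measure_pmf.prob (poisson_pmf h) {0, 1}"
    by (subst measure_pmf.prob_compl[symmetric]) (auto intro!: arg_cong[where f = "measure_pmf.prob _"])
  also have "measure_pmf.prob (poisson_pmf h) {0, 1} = (1 + h) * exp (- h)"
    using h by (subst measure_measure_pmf_finite) (auto simp: algebra_simps)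
  also have "1 - (1 + h) * exp (- h) \<le> 1 - (1 + h) * (1 - h)"
    using exp_ge_add_one_self[of "- h"] h by (intro diff_left_mono mult_left_mono) auto
  finally show ?thesis by (simp add: algebra_simps power2_eq_square)
qed

section \<open>Law and independence of the moves in the time slots\<close>

locale connected_imitation_process = imitation_process M S G \<tau> N \<xi>
  for M :: "'w measure" and S :: "'v pair_pre_digraph" and G :: "'o pair_pre_digraph"
    and \<tau> :: nat and N :: "'v \<times> 'v \<Rightarrow> real \<Rightarrow> 'w \<Rightarrow> nat" and \<xi> :: "real \<Rightarrow> 'w \<Rightarrow> 'v \<Rightarrow> 'o" +
  assumes graph_S: "pair_graph S" and connected_S: "Digraph_Component.connected (with_proj S)"
    and graph_G: "pair_graph G" and connected_G: "Digraph_Component.connected (with_proj G)"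
begin

abbreviation "E \<equiv> parcs S"

lemma finite_E: "finite E" and finite_verts: "finite (pverts S)" and finite_opinions: "finite (pverts G)"
  using graph_S graph_G
  by (auto simp: pair_graph_def pair_digraph_def pair_fin_digraph_def pair_fin_digraph_axioms_def)

text \<open>Slot \<open>k\<close> runs from \<open>k * h\<close> (excluded) to
  \<open>(k + 1) * h\<close> (included). The difference of naturals is never truncated on the arcs
  of \<open>S\<close>, whose counts are monotone in time.\<close>

definition increment :: "real \<Rightarrow> 'v \<times> 'v \<Rightarrow> nat \<Rightarrow> 'w \<Rightarrow> nat" where
  "increment h e k \<omega> = N e (real (Suc k) * h) \<omega> - N e (real k * h) \<omega>"

lemma N_measurable: "e \<in> E \<Longrightarrow> 0 \<le> t \<Longrightarrow> N e t \<in> M \<rightarrow>\<^sub>M count_space UNIV"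
  using rate_one[of e] by (simp add: poisson_process_def)

lemma increment_measurable:
  assumes "0 < h" "e \<in> E"
  shows "increment h e k \<in> M \<rightarrow>\<^sub>M count_space UNIV"
  unfolding increment_def
  using assms by (intro measurable_diff_nat N_measurable) auto

lemma prob_increment:
  assumes "0 < h" "e \<in> E"
  shows "prob {\<omega> \<in> space M. increment h e k \<omega> \<in> A} = measure_pmf.prob (poisson_pmf h) A"
proof -
  have "\<forall>s\<ge>0. \<forall>t>s. distr M (count_space UNIV) (\<lambda>\<omega>. N e t \<omega> - N e s \<omega>) = measure_pmf (poisson_pmf (1 * (t - s)))"
    using rate_one[OF assms(2)] unfolding poisson_process_def by blast
  from this[rule_format, of "real k * h" "real (Suc k) * h"]
  have "distr M (count_space UNIV) (increment h e k) = measure_pmf (poisson_pmf h)"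
    using assms(1) by (simp add: increment_def[abs_def] algebra_simps)
  then have "measure_pmf.prob (poisson_pmf h) A = measure (distr M (count_space UNIV) (increment h e k)) A"
    by simp
  also have "\<dots> = prob (increment h e k -` A \<inter> space M)"
    using increment_measurable[OF assms] by (intro measure_distr) auto
  also have "increment h e k -` A \<inter> space M = {\<omega> \<in> space M. increment h e k \<omega> \<in> A}" by auto
  finally show ?thesis by simp
qed

text \<open>Independence over arcs comes from that of the whole paths, independence over the slots
  of one arc from the Poisson process; the product over pairs is the iterated product.\<close>

lemma indep_increments:
  assumes h: "0 < h"
  shows "indep_vars (\<lambda>_. count_space UNIV) (\<lambda>(e, j). increment h e j) (E \<times> {..<n})"
\<comment> \<open>With no arc or no slot, the intersections below would be \<open>UNIV\<close>
  instead of \<open>space M\<close>.\<close>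
proof (cases "E \<times> {..<n} = {}")
  case True
  show ?thesis unfolding True by (simp add: indep_vars_def indep_sets_def)
next
  case False
  then have ne: "E \<noteq> {}" "{..<n} \<noteq> {}" by auto
  have rv: "random_variable (count_space UNIV) ((\<lambda>(e, j). increment h e j) i)" if "i \<in> E \<times> {..<n}" for i
    using that increment_measurable[OF h] by auto
  show ?thesis
  \<comment> \<open>The sets of naturals are an intersection-stable generator containing the whole
    space, so the product formula over the full finite index set suffices.\<close>
  proof (subst indep_vars_finite[where E = "\<lambda>_. UNIV"])
    show "\<forall>A\<in>E \<times> {..<n} \<rightarrow> UNIV.
        prob (\<Inter>j\<in>E \<times> {..<n}. (\<lambda>(e, j). increment h e j) j -` A j \<inter> space M) =
        (\<Prod>j\<in>E \<times> {..<n}. prob ((\<lambda>(e, j). increment h e j) j -` A j \<inter> space M))"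
    proof
      fix A :: "('v \<times> 'v) \<times> nat \<Rightarrow> nat set"
      let ?path = "\<lambda>e \<omega>. \<lambda>t\<in>{0..}. N e t \<omega>"
      \<comment> \<open>\<open>C e\<close> expresses all requirements on arc \<open>e\<close> as one
        event of its path, to which \<open>indep_edges\<close> applies.\<close>
      define C where "C e = {w \<in> space nat_paths. \<forall>j<n. w (real (Suc j) * h) - w (real j * h) \<in> A (e, j)}" for e
      have C: "C e \<in> sets nat_paths" for e
      proof -
        have "(\<lambda>w. w (real j * h)) \<in> nat_paths \<rightarrow>\<^sub>M count_space UNIV" for j
          using h by (intro measurable_component_singleton) auto
        then have "(\<lambda>w. w (real (Suc j) * h) - w (real j * h)) \<in> nat_paths \<rightarrow>\<^sub>M count_space UNIV" for j
          by (intro measurable_diff_nat)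
        from measurable_sets[OF this]
        have "{w \<in> space nat_paths. w (real (Suc j) * h) - w (real j * h) \<in> A (e, j)} \<in> sets nat_paths" for j
          by (simp add: vimage_def Int_def conj_commute)
        then show ?thesis unfolding C_def
          using sets.sets_Collect_finite_All[of "{..<n}" nat_paths "\<lambda>j w. w (real (Suc j) * h) - w (real j * h) \<in> A (e, j)"] by simp
      qed
      have inC: "?path e -` C e \<inter> space M = (\<Inter>j<n. increment h e j -` A (e, j) \<inter> space M)" for e
        using h ne(2) by (auto simp: C_def space_PiM increment_def)
      have "(\<Inter>j\<in>E \<times> {..<n}. (\<lambda>(e, j). increment h e j) j -` A j \<inter> space M) = (\<Inter>e\<in>E. ?path e -` C e \<inter> space M)"
        unfolding inC using ne by auto
      also have "prob \<dots> = (\<Prod>e\<in>E. prob (?path e -` C e \<inter> space M))"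
        using indep_edges ne(1) finite_E C by (intro indep_varsD_finite) auto
      also have "\<dots> = (\<Prod>e\<in>E. \<Prod>j<n. prob (increment h e j -` A (e, j) \<inter> space M))"
      proof (intro prod.cong refl)
        fix e assume "e \<in> E"
        then have "\<forall>(u :: nat \<Rightarrow> real) n. 0 \<le> u 0 \<and> mono u \<longrightarrow>
            indep_vars (\<lambda>_. count_space UNIV) (\<lambda>i \<omega>. N e (u (Suc i)) \<omega> - N e (u i) \<omega>) {..<n}"
          using rate_one unfolding poisson_process_def by blast
        moreover have "mono (\<lambda>j. real j * h)" using h by (auto intro!: monoI)
        ultimately have "indep_vars (\<lambda>_. count_space UNIV) (\<lambda>j. increment h e j) {..<n}"
          unfolding increment_def by (auto dest: spec[of _ "\<lambda>j. real j * h"])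
        then show "prob (?path e -` C e \<inter> space M) = (\<Prod>j<n. prob (increment h e j -` A (e, j) \<inter> space M))"
          unfolding inC using ne(2) by (intro indep_varsD_finite) auto
      qed
      also have "\<dots> = (\<Prod>j\<in>E \<times> {..<n}. prob ((\<lambda>(e, j). increment h e j) j -` A j \<inter> space M))"
        by (simp add: prod.cartesian_product case_prod_unfold)
      finally show "prob (\<Inter>j\<in>E \<times> {..<n}. (\<lambda>(e, j). increment h e j) j -` A j \<inter> space M) =
        (\<Prod>j\<in>E \<times> {..<n}. prob ((\<lambda>(e, j). increment h e j) j -` A j \<inter> space M))" .
    qed
  qed (use False finite_E rv in \<open>auto simp: Int_stable_def intro: sigma_sets.Basic\<close>)
qed

definition active :: "real \<Rightarrow> nat \<Rightarrow> 'w \<Rightarrow> ('v \<times> 'v) option" where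
  "active h k \<omega> = active_arc E (\<lambda>e. increment h e k \<omega>)"

lemma active_measurable:
  "0 < h \<Longrightarrow> active h k \<in> M \<rightarrow>\<^sub>M count_space (insert None (Some ` E))"
  unfolding active_def[abs_def] using finite_E increment_measurable by (rule measurable_active_arc)

text \<open>The move in slot \<open>j\<close> is a function of the increments with index in
  \<open>E \<times> {j}\<close>, and disjoint blocks of an independent family are
  independent.\<close>

lemma indep_active:
  assumes h: "0 < h"
  shows "indep_vars (\<lambda>_. count_space (insert None (Some ` E))) (active h) {..<n}"
proof -
  have "indep_vars (\<lambda>j. \<Pi>\<^sub>M i\<in>E \<times> {j}. count_space UNIV)
      (\<lambda>j \<omega>. \<lambda>i\<in>E \<times> {j}. (\<lambda>(e, j). increment h e j) i \<omega>) {..<n}"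
    by (rule indep_vars_restrict[OF indep_increments[OF h, of n]]) (auto simp: disjoint_family_on_def)
  then have "indep_vars (\<lambda>_. count_space (insert None (Some ` E)))
      (\<lambda>j \<omega>. active_arc E (\<lambda>e. (\<lambda>i\<in>E \<times> {j}. (\<lambda>(e, j). increment h e j) i \<omega>) (e, j))) {..<n}"
  proof (rule indep_vars_compose2)
    fix j
    show "(\<lambda>v. active_arc E (\<lambda>e. v (e, j))) \<in> (\<Pi>\<^sub>M i\<in>E \<times> {j}. count_space UNIV) \<rightarrow>\<^sub>M count_space (insert None (Some ` E))"
      using finite_E by (rule measurable_active_arc) (auto intro: measurable_component_singleton)
  qed
  moreover have "active_arc E (\<lambda>e. (\<lambda>i\<in>E \<times> {j}. (\<lambda>(e, j). increment h e j) i \<omega>) (e, j)) = active h j \<omega>" for j \<omega>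
    unfolding active_def by (rule active_arc_cong) simp
  ultimately show ?thesis by simp
qed

lemma prob_initial_and_active:
  assumes h: "0 < h" and z: "z \<in> configurations S G" and y: "\<And>j. y j \<in> insert None (Some ` E)"
  shows "prob {\<omega> \<in> space M. \<xi> 0 \<omega> = z \<and> (\<forall>j<n. active h j \<omega> = y j)}
    = prob {\<omega> \<in> space M. \<xi> 0 \<omega> = z} * (\<Prod>j<n. prob {\<omega> \<in> space M. active h j \<omega> = y j})"
proof -
  let ?P = "\<Pi>\<^sub>M e\<in>E. nat_paths"
  let ?path = "\<lambda>\<omega>. \<lambda>e\<in>E. \<lambda>t\<in>{0..}. N e t \<omega>"
  \<comment> \<open>The event about the moves is rewritten on the space of activation paths, where
    \<open>indep_initial\<close> separates it from the initial configuration;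
    \<open>indep_active\<close> then factors it.\<close>
  define B where "B = {w \<in> space ?P. \<forall>j<n. active_arc E (\<lambda>e. w e (real (Suc j) * h) - w e (real j * h)) = y j}"
  have B: "B \<in> sets ?P"
  proof -
    have comp: "(\<lambda>w. w e (real j * h)) \<in> ?P \<rightarrow>\<^sub>M count_space UNIV" if "e \<in> E" for e j
    proof (rule measurable_compose[where N = nat_paths])
      show "(\<lambda>w. w e) \<in> ?P \<rightarrow>\<^sub>M nat_paths" using that by (rule measurable_component_singleton)
      show "(\<lambda>w. w (real j * h)) \<in> nat_paths \<rightarrow>\<^sub>M count_space UNIV"
        using h by (intro measurable_component_singleton) auto
    qed
    have "(\<lambda>w. active_arc E (\<lambda>e. w e (real (Suc j) * h) - w e (real j * h)))
      \<in> ?P \<rightarrow>\<^sub>M count_space (insert None (Some ` E))" for j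
    proof (rule measurable_active_arc[OF finite_E])
      fix e assume "e \<in> E"
      from comp[OF this, of j] comp[OF this, of "Suc j"]
      show "(\<lambda>w. w e (real (Suc j) * h) - w e (real j * h)) \<in> ?P \<rightarrow>\<^sub>M count_space UNIV"
        by (intro measurable_diff_nat)
    qed
    from measurable_sets[OF this, of "{y j}" j for j] y
    have "{w \<in> space ?P. active_arc E (\<lambda>e. w e (real (Suc j) * h) - w e (real j * h)) = y j} \<in> sets ?P" for j
      by (simp add: vimage_def Int_def conj_commute)
    then show ?thesis unfolding B_def
      using sets.sets_Collect_finite_All[of "{..<n}" ?P
          "\<lambda>j w. active_arc E (\<lambda>e. w e (real (Suc j) * h) - w e (real j * h)) = y j"] by simp
  qed
  have eqB: "{\<omega> \<in> space M. \<forall>j<n. active h j \<omega> = y j} = ?path -` B \<inter> space M"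
  proof -
    have "active_arc E (\<lambda>e. ?path \<omega> e (real (Suc j) * h) - ?path \<omega> e (real j * h)) = active h j \<omega>" for \<omega> j
      unfolding active_def increment_def using h by (intro active_arc_cong) auto
    moreover have "?path \<omega> \<in> space ?P" for \<omega> by (auto simp: space_PiM)
    ultimately show ?thesis unfolding B_def by auto
  qed
  have "{\<omega> \<in> space M. \<xi> 0 \<omega> = z \<and> (\<forall>j<n. active h j \<omega> = y j)}
    = (\<xi> 0 -` {z} \<inter> space M) \<inter> (?path -` B \<inter> space M)"
    unfolding eqB[symmetric] by auto
  also have "prob \<dots> = prob (\<xi> 0 -` {z} \<inter> space M) * prob (?path -` B \<inter> space M)"
  proof (rule indep_setD[OF indep_initial])
    show "\<xi> 0 -` {z} \<inter> space M \<in> sets (vimage_algebra (space M) (\<xi> 0) (count_space (configurations S G)))"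
      using z by (intro in_vimage_algebra) auto
    show "?path -` B \<inter> space M \<in> sets (vimage_algebra (space M) ?path ?P)"
      using B by (rule in_vimage_algebra)
  qed
  also have "\<xi> 0 -` {z} \<inter> space M = {\<omega> \<in> space M. \<xi> 0 \<omega> = z}" by auto
  also have "prob (?path -` B \<inter> space M) = (\<Prod>j<n. prob {\<omega> \<in> space M. active h j \<omega> = y j})"
  proof (cases "n = 0")
    case True
    then show ?thesis unfolding eqB[symmetric] by (simp add: prob_space)
  next
    case False
    have "?path -` B \<inter> space M = (\<Inter>j<n. active h j -` {y j} \<inter> space M)"
      unfolding eqB[symmetric] using False by auto
    also have "prob \<dots> = (\<Prod>j<n. prob (active h j -` {y j} \<inter> space M))"
      using False y by (intro indep_varsD_finite[OF indep_active[OF h]]) auto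
    also have "\<dots> = (\<Prod>j<n. prob {\<omega> \<in> space M. active h j \<omega> = y j})"
      by (intro prod.cong refl arg_cong[where f = prob]) auto
    finally show ?thesis .
  qed
  finally show ?thesis .
qed

text \<open>One activation of \<open>e\<close> and none of the other arcs: a factor
  \<open>h * exp (- h)\<close> and \<open>card E - 1\<close> factors \<open>exp (- h)\<close>. The
  value is the same for every \<open>e\<close> and \<open>k\<close>, as \<open>driven_chain\<close>
  demands.\<close>

lemma prob_active_Some:
  assumes h: "0 < h" and e: "e \<in> E"
  shows "prob {\<omega> \<in> space M. active h k \<omega> = Some e} = h * exp (- h * card E)"
proof -
  let ?d = "\<lambda>e'. if e' = e then 1 else 0 :: nat"
  have "{\<omega> \<in> space M. active h k \<omega> = Some e}
    = (\<Inter>i\<in>E \<times> {k}. (\<lambda>(e, j). increment h e j) i -` {?d (fst i)} \<inter> space M)"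
  proof -
    have "active h k \<omega> = Some e \<longleftrightarrow> (\<forall>e'\<in>E. increment h e' k \<omega> = ?d e')" for \<omega>
      unfolding active_def active_arc_eq_Some_iff using e by (metis DiffE DiffI insertI1 singletonD)
    then show ?thesis using e by auto
  qed
  also have "prob \<dots> = (\<Prod>i\<in>E \<times> {k}. prob ((\<lambda>(e, j). increment h e j) i -` {?d (fst i)} \<inter> space M))"
    using e finite_E by (intro indep_varsD[OF indep_increments[OF h, of "Suc k"]]) auto
  also have "\<dots> = (\<Prod>e'\<in>E. prob {\<omega> \<in> space M. increment h e' k \<omega> \<in> {?d e'}})"
    by (intro prod.reindex_cong[where l = "\<lambda>e. (e, k)"])
      (auto simp: inj_on_def intro!: arg_cong[where f = prob])
  also have "\<dots> = (\<Prod>e'\<in>E. pmf (poisson_pmf h) (?d e'))"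
    by (intro prod.cong refl) (simp only: prob_increment[OF h] measure_pmf_single)
  also have "\<dots> = (\<Prod>e'\<in>E. (if e' = e then h else 1) * exp (- h))"
    using h by (intro prod.cong refl) auto
  also have "\<dots> = h * exp (- h) ^ card E"
    using finite_E e by (simp add: prod.distrib)
  also have "exp (- h) ^ card E = exp (- h * card E)"
    by (simp add: exp_of_nat_mult[symmetric] mult.commute)
  finally show ?thesis .
qed

text \<open>The exceptional event that one of the first \<open>n\<close> slots has at least two
  activations, of the same arc or of different ones. Off this event no activation is missed by
  \<open>active\<close>.\<close>

definition crowded :: "real \<Rightarrow> nat \<Rightarrow> 'w set" where
  "crowded h n = {\<omega> \<in> space M. \<exists>j<n. (\<exists>e\<in>E. increment h e j \<omega> \<in> {2..}) \<or>
     (\<exists>e\<in>E. \<exists>e'\<in>E. e \<noteq> e' \<and> increment h e j \<omega> \<in> {1..} \<and> increment h e' j \<omega> \<in> {1..})}"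

text \<open>A union bound: in each slot, \<open>card E\<close> double activations and
  \<open>(card E)\<^sup>2\<close> pairs of arcs, each of probability at most
  \<open>h\<^sup>2\<close>.\<close>

lemma crowded_event_and_prob:
  fixes h :: real
  assumes h: "0 < h"
  shows "crowded h n \<in> events" and "prob (crowded h n) \<le> n * (card E + (card E)\<^sup>2) * h\<^sup>2"
proof -
  let ?X = "\<lambda>j e. {\<omega> \<in> space M. increment h e j \<omega> \<in> {2..}}"
  \<comment> \<open>Pairs with \<open>e = e'\<close> give the empty event, which keeps the index set
    a full product.\<close>
  let ?W = "\<lambda>j (e, e'). {\<omega> \<in> space M. e \<noteq> e' \<and> increment h e j \<omega> \<in> {1..} \<and> increment h e' j \<omega> \<in> {1..}}"
  let ?U = "\<lambda>j. (\<Union>e\<in>E. ?X j e) \<union> (\<Union>i\<in>E \<times> E. ?W j i)"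
  have ev: "{\<omega> \<in> space M. increment h e j \<omega> \<in> A} \<in> events" if "e \<in> E" for e j A
    using measurable_sets[OF increment_measurable[OF h that], of A j] by (simp add: vimage_def Int_def conj_commute)
  have X: "?X j e \<in> events" if "e \<in> E" for j e
    using that by (rule ev)
  have W: "?W j i \<in> events" if "i \<in> E \<times> E" for i j
  proof -
    have "?W j i = (if fst i \<noteq> snd i then {\<omega> \<in> space M. increment h (fst i) j \<omega> \<in> {1..}} \<inter>
        {\<omega> \<in> space M. increment h (snd i) j \<omega> \<in> {1..}} else {})"
      by (auto simp: case_prod_unfold)
    moreover have "fst i \<in> E" "snd i \<in> E" using that by auto
    ultimately show ?thesis
      using sets.Int[OF ev[of "fst i" j "{1..}"] ev[of "snd i" j "{1..}"]]
      by (simp only: sets.empty_sets split: if_split) simp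
  qed
  have U: "?U j \<in> events" for j
    using finite_E X W by (intro sets.Un sets.finite_UN) auto
  have eq: "crowded h n = (\<Union>j<n. ?U j)"
    unfolding crowded_def by fastforce
  show "crowded h n \<in> events" unfolding eq using U by (intro sets.finite_UN) auto
  have pX: "prob (?X j e) \<le> h\<^sup>2" if "e \<in> E" for j e
    unfolding prob_increment[OF h that] using poisson_pmf_prob_ge_2[OF h] .
  have pW: "prob (?W j i) \<le> h\<^sup>2" if i: "i \<in> E \<times> E" for j i
  proof -
    obtain e e' where [simp]: "i = (e, e')" by (cases i)
    have ee: "e \<in> E" "e' \<in> E" using i by auto
    show ?thesis
    proof (cases "e = e'")
      case False
      have "?W j i = (\<Inter>i\<in>{(e, j), (e', j)}. (\<lambda>(e, j). increment h e j) i -` {1..} \<inter> space M)"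
        using False by auto
      also have "prob \<dots> = (\<Prod>i\<in>{(e, j), (e', j)}. prob ((\<lambda>(e, j). increment h e j) i -` {1..} \<inter> space M))"
        using ee by (intro indep_varsD[OF indep_increments[OF h, of "Suc j"]]) auto
      also have "\<dots> = prob {\<omega> \<in> space M. increment h e j \<omega> \<in> {1..}} * prob {\<omega> \<in> space M. increment h e' j \<omega> \<in> {1..}}"
        using False by (simp add: vimage_def Int_def conj_commute)
      also have "\<dots> \<le> h * h"
        unfolding prob_increment[OF h ee(1)] prob_increment[OF h ee(2)]
        using poisson_pmf_prob_ge_1[OF h] h by (intro mult_mono) auto
      finally show ?thesis by (simp add: power2_eq_square)
    qed simp
  qed
  have pU: "prob (?U j) \<le> (card E + (card E)\<^sup>2) * h\<^sup>2" for j
  proof -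
    have "prob (?U j) \<le> prob (\<Union>e\<in>E. ?X j e) + prob (\<Union>i\<in>E \<times> E. ?W j i)"
      using finite_E X W by (intro measure_Un_le sets.finite_UN) auto
    also have "\<dots> \<le> (\<Sum>e\<in>E. prob (?X j e)) + (\<Sum>i\<in>E \<times> E. prob (?W j i))"
      using finite_E X W by (intro add_mono finite_measure_subadditive_finite) auto
    also have "\<dots> \<le> (\<Sum>e\<in>E. h\<^sup>2) + (\<Sum>i\<in>E \<times> E. h\<^sup>2)"
      using pX pW by (intro add_mono sum_mono)
    also have "\<dots> = (card E + (card E)\<^sup>2) * h\<^sup>2"
      by (simp add: card_cartesian_product power2_eq_square algebra_simps)
    finally show ?thesis .
  qed
  have "prob (crowded h n) \<le> (\<Sum>j<n. prob (?U j))"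
    unfolding eq using U by (intro finite_measure_subadditive_finite) auto
  also have "\<dots> \<le> (\<Sum>j<n. (card E + (card E)\<^sup>2) * h\<^sup>2)"
    by (intro sum_mono pU)
  finally show "prob (crowded h n) \<le> n * (card E + (card E)\<^sup>2) * h\<^sup>2"
    by simp
qed

end

section \<open>Consensus on a central opinion\<close>

lemma ereal_Inf_image_of_least:
  assumes "t \<in> A" "\<forall>s\<in>A. t \<le> s"
  shows "Inf (ereal ` A) = ereal t"
  using assms by (intro Inf_eqI) auto

text \<open>By right continuity the path has at the infimum the value it takes at a nearby element
  of the set, and keeps it from then on. So a finite fixation time is attained, and the state at
  that time is the final one.\<close>

lemma fixation_set_has_least:
  fixes X :: "real \<Rightarrow> 'a"
  assumes right: "\<And>t. 0 \<le> t \<Longrightarrow> \<forall>\<^sub>F s in at_right t. X s = X t"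
    and ne: "{t. 0 \<le> t \<and> (\<forall>s>t. X t = X s)} \<noteq> {}" (is "?A \<noteq> {}")
  obtains t where "t \<in> {t. 0 \<le> t \<and> (\<forall>s>t. X t = X s)}"
    "\<forall>s\<in>{t. 0 \<le> t \<and> (\<forall>s>t. X t = X s)}. t \<le> s"
proof -
  define u where "u = Inf ?A"
  have bdd: "bdd_below ?A" by (rule bdd_belowI[of _ 0]) auto
  have low: "u \<le> s" if "s \<in> ?A" for s
    unfolding u_def using that bdd by (rule cInf_lower)
  have "0 \<le> u" unfolding u_def using ne by (intro cInf_greatest) auto
  from right[OF this] obtain d where d: "d > u" "\<And>r. u < r \<Longrightarrow> r < d \<Longrightarrow> X r = X u"
    by (auto simp: eventually_at_right[of u "u + 1"])
  obtain t where t: "t \<in> ?A" "t < d"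
    using d(1) cInf_less_iff[OF ne bdd, of d] unfolding u_def by auto
  have tu: "X t = X u" using low[OF t(1)] t(2) d(2)[of t] by (cases "t = u") auto
  have "X u = X s" if "s > u" for s
  proof (cases "s < d")
    case False
    then have "t < s" using t(2) by simp
    then have "X t = X s" using t(1) by blast
    then show ?thesis using tu by simp
  qed (use d(2)[of s] that in simp)
  then have "u \<in> ?A" using \<open>0 \<le> u\<close> by auto
  then show thesis using low that by blast
qed

context connected_imitation_process
begin

section \<open>Eventual consensus as a measurable event\<close>

lemma state_in: "\<omega> \<in> space M \<Longrightarrow> 0 \<le> t \<Longrightarrow> \<xi> t \<omega> \<in> configurations S G"
  using measurable_space[OF measurable_state] by simp

lemma finite_configurations: "finite (configurations S G)"
  using finite_verts finite_opinions by (intro finite_PiE) auto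

lemma verts_nonempty: "pverts S \<noteq> {}" and opinions_nonempty: "pverts G \<noteq> {}"
  using connected_S connected_G by (auto simp: connected_conv)

lemma card_verts_pos: "0 < card (pverts S)"
  using verts_nonempty finite_verts by (simp add: card_gt_0_iff)

lemma state_event: "0 \<le> t \<Longrightarrow> {\<omega> \<in> space M. P (\<xi> t \<omega>)} \<in> events"
proof -
  assume t: "0 \<le> t"
  have "{\<omega> \<in> space M. P (\<xi> t \<omega>)} = \<xi> t -` {z \<in> configurations S G. P z} \<inter> space M"
    using state_in[OF _ t] by auto
  also have "\<dots> \<in> events"
    by (rule measurable_sets[OF measurable_state[OF t]]) auto
  finally show ?thesis .
qed

text \<open>The time bound \<open>n\<close> is a natural number so that the event is a countable
  union.\<close>

definition settled :: "'o \<Rightarrow> 'w set" where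
  "settled a = {\<omega> \<in> space M. \<exists>n::nat. \<forall>s\<ge>real n. \<forall>x\<in>pverts S. \<xi> s \<omega> x = a}"

text \<open>By right continuity the state at any time is also the state at some slightly later
  rational time, so countably many times suffice.\<close>

lemma settled_event: "settled a \<in> events"
proof -
  have rat: "(\<forall>s\<ge>real n. \<forall>x\<in>pverts S. \<xi> s \<omega> x = a) \<longleftrightarrow>
      (\<forall>q::rat. real n \<le> of_rat q \<longrightarrow> (\<forall>x\<in>pverts S. \<xi> (of_rat q) \<omega> x = a))" (is "?L \<longleftrightarrow> ?R")
    if \<omega>: "\<omega> \<in> space M" for \<omega> and n :: nat
  proof
    assume R: ?R
    show ?L
    proof (intro allI impI)
      fix s assume s: "real n \<le> s"
      then have "0 \<le> s" by (meson of_nat_0_le_iff order_trans)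
      from right_continuous[OF \<omega> this]
      obtain d where d: "d > s" "\<And>r. s < r \<Longrightarrow> r < d \<Longrightarrow> \<xi> r \<omega> = \<xi> s \<omega>"
        by (auto simp: eventually_at_right[of s "s + 1"])
      obtain q where "s < of_rat q" "of_rat q < d" using of_rat_dense[OF d(1)] by blast
      then have "\<xi> (of_rat q) \<omega> = \<xi> s \<omega>" "real n \<le> of_rat q" using d(2) s by auto
      then show "\<forall>x\<in>pverts S. \<xi> s \<omega> x = a" using R by metis
    qed
  qed simp
  have "settled a = {\<omega> \<in> space M. \<exists>n::nat. \<forall>q::rat. real n \<le> of_rat q \<longrightarrow>
      (\<forall>x\<in>pverts S. \<xi> (of_rat q) \<omega> x = a)}"
    unfolding settled_def by (intro Collect_cong conj_cong refl ex_cong1 rat)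
  also have "\<dots> = (\<Union>n::nat. \<Inter>q::rat.
      {\<omega> \<in> space M. real n \<le> of_rat q \<longrightarrow> (\<forall>x\<in>pverts S. \<xi> (of_rat q) \<omega> x = a)})"
    by auto
  also have "\<dots> \<in> events"
  proof (intro sets.countable_UN sets.countable_INT image_subsetI)
    fix n :: nat and q :: rat
    show "{\<omega> \<in> space M. real n \<le> of_rat q \<longrightarrow> (\<forall>x\<in>pverts S. \<xi> (of_rat q) \<omega> x = a)} \<in> events"
    proof (cases "real n \<le> of_rat q")
      case True
      then have "0 \<le> (of_rat q :: real)" by (meson of_nat_0_le_iff order_trans)
      then show ?thesis using state_event[of "of_rat q" "\<lambda>z. \<forall>x\<in>pverts S. z x = a"] True by simp
    qed simp
  qed auto
  finally show ?thesis .
qed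

text \<open>The state at the fixation time persists, so it is constant exactly if the path ends in
  that constant. This makes the event measurable and splits it by the winning opinion.\<close>

lemma consensus_event_eq: "consensus_event M S G \<xi> = (\<Union>a\<in>pverts G. settled a)"
proof (intro equalityI subsetI)
  fix \<omega> assume "\<omega> \<in> consensus_event M S G \<xi>"
  then obtain c where \<omega>: "\<omega> \<in> space M" and fin: "fixation_time \<xi> \<omega> < \<infinity>"
    and c: "c \<in> pverts G" "\<forall>x\<in>pverts S. \<xi> (real_of_ereal (fixation_time \<xi> \<omega>)) \<omega> x = c"
    by (auto simp: consensus_event_def)
  have "{t. 0 \<le> t \<and> (\<forall>s>t. \<xi> t \<omega> = \<xi> s \<omega>)} \<noteq> {}" (is "?A \<noteq> {}")
  proof
    assume "?A = {}"
    then show False using fin by (simp only: fixation_time_def image_empty Inf_empty) (simp add: top_ereal_def)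
  qed
  with right_continuous[OF \<omega>] obtain t where t: "t \<in> ?A" "\<forall>s\<in>?A. t \<le> s"
    by (rule fixation_set_has_least)
  then have "fixation_time \<xi> \<omega> = ereal t"
    unfolding fixation_time_def by (rule ereal_Inf_image_of_least)
  then have c': "\<forall>x\<in>pverts S. \<xi> t \<omega> x = c" using c(2) by simp
  have "\<xi> s \<omega> x = c" if "t \<le> s" "x \<in> pverts S" for s x
  proof -
    have "\<xi> t \<omega> = \<xi> s \<omega>" using t(1) that(1) by (cases "t < s") auto
    then show ?thesis using c' that(2) by metis
  qed
  then have "\<forall>s\<ge>real (nat \<lceil>t\<rceil>). \<forall>x\<in>pverts S. \<xi> s \<omega> x = c"
    by (meson order_trans real_nat_ceiling_ge)
  then show "\<omega> \<in> (\<Union>a\<in>pverts G. settled a)"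
    using c(1) \<omega> unfolding settled_def by blast
next
  fix \<omega> assume "\<omega> \<in> (\<Union>a\<in>pverts G. settled a)"
  then obtain a n where a: "a \<in> pverts G" and \<omega>: "\<omega> \<in> space M"
    and n: "\<And>s x. s \<ge> real n \<Longrightarrow> x \<in> pverts S \<Longrightarrow> \<xi> s \<omega> x = a"
    by (auto simp: settled_def)
  let ?A = "{t. 0 \<le> t \<and> (\<forall>s>t. \<xi> t \<omega> = \<xi> s \<omega>)}"
  have "real n \<in> ?A"
  proof safe
    fix s assume s: "real n < s"
    then have "0 \<le> s" by (meson less_imp_le of_nat_0_le_iff order_trans)
    \<comment> \<open>Configurations are extensional, so agreement on \<open>pverts S\<close> is
      equality.\<close>
    then show "\<xi> (real n) \<omega> = \<xi> s \<omega>"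
      using state_in[OF \<omega>, of "real n"] state_in[OF \<omega>, of s] n s
      by (intro PiE_ext) auto
  qed simp
  then have "?A \<noteq> {}" by blast
  with right_continuous[OF \<omega>] obtain t where t: "t \<in> ?A" "\<forall>s\<in>?A. t \<le> s"
    by (rule fixation_set_has_least)
  then have T: "fixation_time \<xi> \<omega> = ereal t"
    unfolding fixation_time_def by (rule ereal_Inf_image_of_least)
  \<comment> \<open>This time is strictly later than \<open>t\<close>, so the state is unchanged,
    and later than \<open>n\<close>, so it is constantly \<open>a\<close>.\<close>
  have "\<xi> t \<omega> = \<xi> (max t (real n) + 1) \<omega>" using t(1) by auto
  then have "\<forall>x\<in>pverts S. \<xi> t \<omega> x = a" using n by simp
  then show "\<omega> \<in> consensus_event M S G \<xi>"
    unfolding consensus_event_def using \<omega> a T by auto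
qed

lemma consensus_event_event: "consensus_event M S G \<xi> \<in> events"
  unfolding consensus_event_eq using finite_opinions settled_event by auto

text \<open>A constant configuration is fixed by every imitation step, since \<open>a\<close> is at
  distance \<open>0\<close> from itself. The inclusion of the events holds almost surely, like
  \<open>dynamics\<close>.\<close>

lemma prob_consensus_at_le_settled:
  assumes a: "a \<in> pverts G"
  shows "prob {\<omega> \<in> space M. \<forall>x\<in>pverts S. \<xi> (real m) \<omega> x = a} \<le> prob (settled a)"
proof (rule finite_measure_mono_AE[OF _ settled_event])
  show "AE \<omega> in M. \<omega> \<in> {\<omega> \<in> space M. \<forall>x\<in>pverts S. \<xi> (real m) \<omega> x = a} \<longrightarrow> \<omega> \<in> settled a"
    using dynamics
  proof (rule AE_mp, intro AE_I2 impI)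
    fix \<omega> assume \<omega>: "\<omega> \<in> space M"
      and dyn: "\<forall>t>0. \<exists>\<eta>. (\<forall>\<^sub>F s in at_left t. \<xi> s \<omega> = \<eta>) \<and>
         (\<forall>e\<in>E. jumps_at (N e) \<omega> t \<longrightarrow> \<xi> t \<omega> = imitate G \<tau> e \<eta>) \<and>
         ((\<forall>e\<in>E. \<not> jumps_at (N e) \<omega> t) \<longrightarrow> \<xi> t \<omega> = \<eta>)"
      and "\<omega> \<in> {\<omega> \<in> space M. \<forall>x\<in>pverts S. \<xi> (real m) \<omega> x = a}"
    then have m: "\<forall>x\<in>pverts S. \<xi> (real m) \<omega> x = a" by simp
    interpret S: pair_graph S by (rule graph_S)
    have stay: "imitate G \<tau> e (\<xi> (real m) \<omega>) = \<xi> (real m) \<omega>" if "e \<in> E" for e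
      using m S.arc_fst_in_verts[OF that] S.arc_snd_in_verts[OF that] geodesic_dist_self[OF graph_G a]
      by (simp add: imitate_def)
    have "\<xi> s \<omega> = \<xi> (real m) \<omega>" if s: "real m \<le> s" for s
    proof (rule right_continuous_path_invariant[where X = "\<lambda>t. \<xi> t \<omega>", OF s refl])
      fix u assume u: "real m < u" "u \<le> s"
      then have "0 < u" by (meson le_less_trans of_nat_0_le_iff)
      then show "\<exists>\<eta>. (\<forall>\<^sub>F r in at_left u. \<xi> r \<omega> = \<eta>) \<and> (\<eta> = \<xi> (real m) \<omega> \<longrightarrow> \<xi> u \<omega> = \<xi> (real m) \<omega>)"
        using dyn stay by metis
    next
      fix u assume "real m \<le> u"
      then have "0 \<le> u" by (meson of_nat_0_le_iff order_trans)
      then show "\<forall>\<^sub>F r in at_right u. \<xi> r \<omega> = \<xi> u \<omega>" by (rule right_continuous[OF \<omega>])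
    qed
    then have "\<forall>s\<ge>real m. \<forall>x\<in>pverts S. \<xi> s \<omega> x = a" using m by metis
    then show "\<omega> \<in> settled a" using \<omega> unfolding settled_def by blast
  qed
qed

section \<open>Comparison with the discretised chain\<close>

primrec chain :: "real \<Rightarrow> nat \<Rightarrow> 'w \<Rightarrow> 'v \<Rightarrow> 'o" where
  "chain h 0 \<omega> = \<xi> 0 \<omega>"
| "chain h (Suc k) \<omega> = imitate_option G \<tau> (active h k \<omega>) (chain h k \<omega>)"

text \<open>Slot by slot, \<open>path_step\<close> shows that process and chain make the same move
  as long as no slot is crowded.\<close>

lemma AE_chain_eq_state:
  assumes h: "0 < h"
  shows "AE \<omega> in M. \<omega> \<notin> crowded h n \<longrightarrow> chain h n \<omega> = \<xi> (real n * h) \<omega>"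
  using dynamics
proof (rule AE_mp, intro AE_I2 impI)
  fix \<omega> assume \<omega>: "\<omega> \<in> space M"
    and dyn: "\<forall>t>0. \<exists>\<eta>. (\<forall>\<^sub>F s in at_left t. \<xi> s \<omega> = \<eta>) \<and>
       (\<forall>e\<in>E. jumps_at (N e) \<omega> t \<longrightarrow> \<xi> t \<omega> = imitate G \<tau> e \<eta>) \<and>
       ((\<forall>e\<in>E. \<not> jumps_at (N e) \<omega> t) \<longrightarrow> \<xi> t \<omega> = \<eta>)"
    and nc: "\<omega> \<notin> crowded h n"
  have N: "mono_on {0..} (\<lambda>t. N e t \<omega>)" "\<And>t. 0 \<le> t \<Longrightarrow> \<forall>\<^sub>F s in at_right t. N e s \<omega> = N e t \<omega>"
    if "e \<in> E" for e
    using rate_one[OF that] \<omega> unfolding poisson_process_def by blast+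
  have "chain h k \<omega> = \<xi> (real k * h) \<omega>" if "k \<le> n" for k
    using that
  proof (induction k)
    case (Suc k)
    have "\<xi> (real (Suc k) * h) \<omega> = imitate_option G \<tau> (active_arc E
        (\<lambda>e. N e (real (Suc k) * h) \<omega> - N e (real k * h) \<omega>)) (\<xi> (real k * h) \<omega>)"
    proof (rule path_step)
      have "k < n" using Suc.prems by simp
      then have free: "\<not> (\<exists>e\<in>E. increment h e k \<omega> \<in> {2..})"
        "\<not> (\<exists>e\<in>E. \<exists>e'\<in>E. e \<noteq> e' \<and> increment h e k \<omega> \<in> {1..} \<and> increment h e' k \<omega> \<in> {1..})"
        using nc \<omega> unfolding crowded_def by blast+
      have le1: "increment h e k \<omega> \<le> 1" if "e \<in> E" for e
      proof -
        have "increment h e k \<omega> \<notin> {2..}" using free(1) that by blast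
        then show ?thesis by simp
      qed
      have single: "increment h e k \<omega> = 0 \<or> increment h e' k \<omega> = 0"
        if "e \<in> E" "e' \<in> E" "e \<noteq> e'" for e e'
      proof -
        have "increment h e k \<omega> \<notin> {1..} \<or> increment h e' k \<omega> \<notin> {1..}" using free(2) that by blast
        then show ?thesis by auto
      qed
      show "N e (real (Suc k) * h) \<omega> - N e (real k * h) \<omega> \<le> 1" if "e \<in> E" for e
        using le1[OF that] by (simp only: increment_def)
      show "N e (real (Suc k) * h) \<omega> - N e (real k * h) \<omega> = 0 \<or> N e' (real (Suc k) * h) \<omega> - N e' (real k * h) \<omega> = 0"
        if "e \<in> E" "e' \<in> E" "e \<noteq> e'" for e e'
        using single[OF that] by (simp only: increment_def)
    qed (use right_continuous[OF \<omega>] N dyn h in auto)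
    then show ?case using Suc by (simp only: chain.simps active_def increment_def)
  qed simp
  then show "chain h n \<omega> = \<xi> (real n * h) \<omega>" by simp
qed

lemma driven_chain_chain:
  assumes h: "0 < h"
  shows "driven_chain M (configurations S G) E (chain h) (active h) (imitate G \<tau>) (h * exp (- h * card E))"
proof (unfold_locales)
  show "finite (configurations S G)" by (rule finite_configurations)
  show "finite E" by (rule finite_E)
  show "random_variable (count_space (configurations S G)) (chain h 0)"
    using measurable_state[of 0] by (simp add: chain.simps(1)[abs_def])
  show "random_variable (count_space (insert None (Some ` E))) (active h k)" for k
    using h by (rule active_measurable)
  show "chain h (Suc k) \<omega> = (case active h k \<omega> of None \<Rightarrow> chain h k \<omega> | Some e \<Rightarrow> imitate G \<tau> e (chain h k \<omega>))" for \<omega> k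
    by (simp add: imitate_option_def)
  show "imitate G \<tau> e z \<in> configurations S G" if "e \<in> E" "z \<in> configurations S G" for e z
    using graph_S that by (rule imitate_in_configurations)
  show "prob {\<omega> \<in> space M. active h k \<omega> = Some e} = h * exp (- h * card E)" if "e \<in> E" for e k
    using h that by (rule prob_active_Some)
  show "prob {\<omega> \<in> space M. chain h 0 \<omega> = z \<and> (\<forall>j<n. active h j \<omega> = y j)}
      = prob {\<omega> \<in> space M. chain h 0 \<omega> = z} * (\<Prod>j<n. prob {\<omega> \<in> space M. active h j \<omega> = y j})"
    if "z \<in> configurations S G" "\<And>j. y j \<in> insert None (Some ` E)" for z y n
    using prob_initial_and_active[OF h that] by simp
qed

text \<open>The martingale identity moves the mean count to step \<open>n\<close> of the chain,
  where a positive count means all vertices hold \<open>a\<close> or the state is still in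
  \<open>B\<close>. The first term of \<open>c\<close> bounds the probability of \<open>B\<close>,
  the second that of a crowded slot.\<close>

lemma expectation_opinion_count_le_at:
  assumes a: "a \<in> pverts G" "eccentricity G a \<le> \<tau>" and m: "0 < m"
  defines "c \<equiv> (real (card (pverts S)))\<^sup>2 * exp (card E) + (card E + (card E)\<^sup>2)"
  shows "expectation (\<lambda>\<omega>. opinion_count S a (\<xi> 0 \<omega>)) \<le> card (pverts S) * (prob (settled a) + c / real m)"
proof -
  \<comment> \<open>The \<open>n\<close> slots reach time \<open>n * h = m\<close>, long enough for
    absorption, while \<open>n * h\<^sup>2 = 1 / m\<close> makes crowded slots rare.\<close>
  define h where "h = 1 / (real m)\<^sup>2"
  define n where "n = m ^ 3"
  define p where "p = h * exp (- h * card E)"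
  have h: "0 < h" "h \<le> 1" using m by (auto simp: h_def divide_simps)
  have nh: "real n * h = real m" "real n * h\<^sup>2 = 1 / real m"
    using m by (auto simp: h_def n_def field_simps power2_eq_square power3_eq_cube)
  interpret chain: driven_chain M "configurations S G" E "chain h" "active h" "imitate G \<tau>" p
    unfolding p_def using h(1) by (rule driven_chain_chain)
  let ?f = "\<lambda>z. real (opinion_count S a z)" and ?V = "real (card (pverts S))"
  define B where "B = {z. 0 < opinion_count S a z \<and> opinion_count S a z < card (pverts S)}"
  let ?PB = "prob {\<omega> \<in> space M. chain h n \<omega> \<in> B}"
  let ?PF = "prob {\<omega> \<in> space M. chain h n \<omega> \<in> {z. opinion_count S a z = card (pverts S)}}"
  have ev: "{\<omega> \<in> space M. chain h n \<omega> \<in> A} \<in> events" for A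
  proof -
    have "{\<omega> \<in> space M. chain h n \<omega> \<in> A} = chain h n -` (A \<inter> configurations S G) \<inter> space M"
      using measurable_space[OF chain.Z_measurable, of _ n] by auto
    then show ?thesis using measurable_sets[OF chain.Z_measurable, of "A \<inter> configurations S G" n] by simp
  qed
  have int: "integrable M (\<lambda>\<omega>. indicator {\<omega> \<in> space M. chain h n \<omega> \<in> A} \<omega> :: real)" for A
    by (rule integrable_real_indicator[OF ev]) (simp add: emeasure_eq_measure)
  have "real n * p * ?PB \<le> ?V\<^sup>2"
  proof (rule chain.prob_not_absorbed_le[where f = ?f])
    show "0 \<le> p" using h by (simp add: p_def)
    show "of_bool (z \<in> B) \<le> (\<Sum>e\<in>E. (?f (imitate G \<tau> e z))\<^sup>2 - (?f z)\<^sup>2)" if "z \<in> configurations S G" for z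
      using sum_opinion_count_imitate_sq[OF graph_S connected_S graph_G connected_G a that] by (simp add: B_def)
    show "imitate G \<tau> e z \<notin> B" if "z \<in> configurations S G" "z \<notin> B" "e \<in> E" for z e
      using opinion_count_imitate_extreme[OF graph_S graph_G connected_G a that(1,3)] that(2) by (simp add: B_def)
    show "0 \<le> ?f z \<and> ?f z \<le> ?V" for z using opinion_count_le[OF graph_S] by simp
  qed
  \<comment> \<open>Since \<open>h \<le> 1\<close>, the factor \<open>exp (- h * card E)\<close> in
    \<open>p\<close> is at least \<open>exp (- card E)\<close>, a bound free of \<open>m\<close>;
    this is the source of \<open>exp (card E)\<close> in \<open>c\<close>.\<close>
  moreover have "real m * exp (- real (card E)) \<le> real n * p"
  proof -
    have "h * card E \<le> 1 * real (card E)" using h by (intro mult_right_mono) auto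
    then have "real m * exp (- real (card E)) \<le> real m * exp (- h * card E)"
      by (intro mult_left_mono) auto
    also have "\<dots> = real n * p" by (simp add: p_def nh(1)[symmetric])
    finally show ?thesis .
  qed
  ultimately have "real m * exp (- real (card E)) * ?PB \<le> ?V\<^sup>2"
    by (meson measure_nonneg mult_right_mono order_trans)
  then have PB: "?PB \<le> ?V\<^sup>2 * exp (card E) / m"
    using m by (simp add: field_simps exp_minus)
  have PF: "?PF \<le> prob (settled a) + (card E + (card E)\<^sup>2) / m"
  proof -
    let ?C = "{\<omega> \<in> space M. \<forall>x\<in>pverts S. \<xi> (real m) \<omega> x = a}"
    have C: "?C \<in> events" using state_event[of "real m" "\<lambda>z. \<forall>x\<in>pverts S. z x = a"] by simp
    \<comment> \<open>Off \<open>crowded h n\<close>, the chain after \<open>n\<close> slots is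
      almost surely the state at time \<open>m\<close>.\<close>
    have "?PF \<le> prob (?C \<union> crowded h n)"
    proof (rule finite_measure_mono_AE)
      show "AE \<omega> in M. \<omega> \<in> {\<omega> \<in> space M. chain h n \<omega> \<in> {z. opinion_count S a z = card (pverts S)}}
          \<longrightarrow> \<omega> \<in> ?C \<union> crowded h n"
        using AE_chain_eq_state[OF h(1), of n]
        by eventually_elim (auto simp: nh(1) opinion_count_eq_card_iff[OF graph_S])
    qed (use C crowded_event_and_prob(1)[OF h(1)] in auto)
    also have "\<dots> \<le> prob ?C + prob (crowded h n)"
      using C crowded_event_and_prob(1)[OF h(1)] by (rule measure_Un_le)
    also have "\<dots> \<le> prob (settled a) + (card E + (card E)\<^sup>2) / m"
    proof (rule add_mono)
      show "prob ?C \<le> prob (settled a)" using a(1) by (rule prob_consensus_at_le_settled)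
      have "real (n * (card E + (card E)\<^sup>2)) * h\<^sup>2 = (card E + (card E)\<^sup>2) * (real n * h\<^sup>2)" by simp
      then show "prob (crowded h n) \<le> (card E + (card E)\<^sup>2) / m"
        using crowded_event_and_prob(2)[OF h(1), of n] by (simp add: nh(2))
    qed
    finally show ?thesis .
  qed
  have "expectation (\<lambda>\<omega>. ?f (\<xi> 0 \<omega>)) = expectation (\<lambda>\<omega>. ?f (chain h n \<omega>))"
    using chain.expectation_martingale[of ?f n] sum_opinion_count_imitate[OF graph_S graph_G connected_G a] by simp
  \<comment> \<open>The count is at most \<open>?V\<close> if all vertices hold \<open>a\<close> or
    the state is in \<open>B\<close>, and it is \<open>0\<close> otherwise.\<close>
  also have "\<dots> \<le> expectation (\<lambda>\<omega>. ?V * indicator {\<omega> \<in> space M. chain h n \<omega> \<in> {z. opinion_count S a z = card (pverts S)}} \<omega>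
      + ?V * indicator {\<omega> \<in> space M. chain h n \<omega> \<in> B} \<omega>)"
  proof (rule integral_mono)
    show "integrable M (\<lambda>\<omega>. ?f (chain h n \<omega>))"
    proof (rule integrable_const_bound)
      show "AE \<omega> in M. norm (?f (chain h n \<omega>)) \<le> ?V"
        by (intro AE_I2) (simp add: opinion_count_le[OF graph_S])
      show "(\<lambda>\<omega>. ?f (chain h n \<omega>)) \<in> borel_measurable M"
        using chain.Z_measurable by (rule measurable_compose) auto
    qed
    show "integrable M (\<lambda>\<omega>. ?V * indicator {\<omega> \<in> space M. chain h n \<omega> \<in> {z. opinion_count S a z = card (pverts S)}} \<omega>
      + ?V * indicator {\<omega> \<in> space M. chain h n \<omega> \<in> B} \<omega>)"
      by (intro Bochner_Integration.integrable_add integrable_mult_right int)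
    fix \<omega> assume "\<omega> \<in> space M"
    then show "?f (chain h n \<omega>) \<le> ?V * indicator {\<omega> \<in> space M. chain h n \<omega> \<in> {z. opinion_count S a z = card (pverts S)}} \<omega>
      + ?V * indicator {\<omega> \<in> space M. chain h n \<omega> \<in> B} \<omega>"
      using opinion_count_le[OF graph_S, of a "chain h n \<omega>"] by (auto simp: indicator_def B_def)
  qed
  also have "\<dots> = ?V * ?PF + ?V * ?PB"
  proof -
    have i: "integrable M (\<lambda>\<omega>. ?V * indicator {\<omega> \<in> space M. chain h n \<omega> \<in> A} \<omega>)" for A
      by (intro integrable_mult_right int)
    have e: "expectation (\<lambda>\<omega>. ?V * indicator {\<omega> \<in> space M. chain h n \<omega> \<in> A} \<omega>)
        = ?V * prob {\<omega> \<in> space M. chain h n \<omega> \<in> A}" for A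
      using sets.Int_space_eq2[OF ev[of A]] by simp
    show ?thesis by (simp only: Bochner_Integration.integral_add[OF i i] e)
  qed
  also have "\<dots> = ?V * (?PF + ?PB)" by (simp add: distrib_left)
  also have "\<dots> \<le> ?V * (prob (settled a) + c / m)"
    using PB PF unfolding c_def add_divide_distrib[of "_ * _"] by (intro mult_left_mono) linarith+
  finally show ?thesis .
qed

text \<open>Neither the mean initial count nor \<open>c\<close> depends on \<open>m\<close>, so the
  error \<open>c / m\<close> disappears in the limit.\<close>

lemma expectation_opinion_count_le:
  assumes "a \<in> pverts G" "eccentricity G a \<le> \<tau>"
  shows "expectation (\<lambda>\<omega>. opinion_count S a (\<xi> 0 \<omega>)) \<le> card (pverts S) * prob (settled a)"
proof -
  define c where "c = (real (card (pverts S)))\<^sup>2 * exp (card E) + (card E + (card E)\<^sup>2)"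
  have "(\<lambda>m. card (pverts S) * (prob (settled a) + c / real m)) \<longlonglongrightarrow> card (pverts S) * (prob (settled a) + 0)"
    by (intro tendsto_intros lim_const_over_n)
  then show ?thesis
    using expectation_opinion_count_le_at[OF assms] unfolding c_def[symmetric]
    by (intro LIMSEQ_le_const) (auto intro!: exI[of _ 1])
qed

section \<open>Summation over the central opinions\<close>

lemma card_central_eq_sum:
  assumes "\<eta> \<in> configurations S G"
  shows "card {x \<in> pverts S. eccentricity G (\<eta> x) \<le> \<tau>}
    = (\<Sum>a\<in>{a \<in> pverts G. eccentricity G a \<le> \<tau>}. opinion_count S a \<eta>)"
proof -
  have "{x \<in> pverts S. eccentricity G (\<eta> x) \<le> \<tau>}
    = (\<Union>a\<in>{a \<in> pverts G. eccentricity G a \<le> \<tau>}. {x \<in> pverts S. \<eta> x = a})"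
    using assms by auto
  then show ?thesis
    unfolding opinion_count_def using finite_verts finite_opinions
    by (simp only:) (intro card_UN_disjoint; auto)
qed

text \<open>The bounds for the single central opinions add up by linearity; consensuses on different
  opinions exclude each other, so the probabilities add up to that of a union inside the consensus
  event.\<close>

lemma expectation_card_central_le:
  "expectation (\<lambda>\<omega>. real (card {x \<in> pverts S. eccentricity G (\<xi> 0 \<omega> x) \<le> \<tau>}))
    \<le> card (pverts S) * prob (consensus_event M S G \<xi>)"
proof -
  let ?C = "{a \<in> pverts G. eccentricity G a \<le> \<tau>}"
  have C: "finite ?C" using finite_opinions by simp
  note fin = expectation_finite_range[OF measurable_state[OF order_refl] finite_configurations]
  \<comment> \<open>Two opinions would have to be held at one vertex at the same late time; a vertex
    exists because \<open>S\<close> is connected.\<close>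
  have disj: "disjoint_family_on settled ?C"
  proof -
    have "a = b" if ab: "\<omega> \<in> settled a" "\<omega> \<in> settled b" for a b \<omega>
    proof -
      obtain x where "x \<in> pverts S" using verts_nonempty by blast
      moreover obtain k l :: nat where "\<forall>s\<ge>real k. \<forall>x\<in>pverts S. \<xi> s \<omega> x = a" "\<forall>s\<ge>real l. \<forall>x\<in>pverts S. \<xi> s \<omega> x = b"
        using ab unfolding settled_def by blast
      ultimately have "\<xi> (max (real k) (real l)) \<omega> x = a" "\<xi> (max (real k) (real l)) \<omega> x = b"
        by (meson max.cobounded1, meson max.cobounded2)
      then show ?thesis by simp
    qed
    then show ?thesis by (auto simp: disjoint_family_on_def)
  qed
  have "expectation (\<lambda>\<omega>. real (card {x \<in> pverts S. eccentricity G (\<xi> 0 \<omega> x) \<le> \<tau>}))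
    = (\<Sum>z\<in>configurations S G. prob {\<omega> \<in> space M. \<xi> 0 \<omega> = z} * (\<Sum>a\<in>?C. real (opinion_count S a z)))"
    unfolding fin[of "\<lambda>z. real (card {x \<in> pverts S. eccentricity G (z x) \<le> \<tau>})"]
    by (intro sum.cong refl) (simp add: card_central_eq_sum)
  also have "\<dots> = (\<Sum>a\<in>?C. expectation (\<lambda>\<omega>. opinion_count S a (\<xi> 0 \<omega>)))"
    unfolding fin[of "\<lambda>z. real (opinion_count S a z)" for a] sum_distrib_left by (rule sum.swap)
  also have "\<dots> \<le> (\<Sum>a\<in>?C. card (pverts S) * prob (settled a))"
    by (intro sum_mono expectation_opinion_count_le) auto
  also have "\<dots> = card (pverts S) * prob (\<Union>a\<in>?C. settled a)"
    using finite_measure_finite_Union[OF C _ disj] settled_event by (simp add: sum_distrib_left image_subset_iff)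
  also have "\<dots> \<le> card (pverts S) * prob (consensus_event M S G \<xi>)"
    by (intro mult_left_mono finite_measure_mono consensus_event_event) (auto simp: consensus_event_eq)
  finally show ?thesis .
qed

text \<open>Linearity over the vertices: each holds a central opinion with probability equal to the
  proportion of central opinions.\<close>

lemma expectation_card_central_uniform:
  assumes "uniform_product_initial M S G (\<xi> 0)"
  shows "expectation (\<lambda>\<omega>. real (card {x \<in> pverts S. eccentricity G (\<xi> 0 \<omega> x) \<le> \<tau>}))
    = card (pverts S) * (card {a \<in> pverts G. eccentricity G a \<le> \<tau>} / card (pverts G))"
proof -
  let ?C = "{a \<in> pverts G. eccentricity G a \<le> \<tau>}"
  let ?A = "\<lambda>x. {\<omega> \<in> space M. \<xi> 0 \<omega> x \<in> ?C}"
  have ev: "?A x \<in> events" for x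
    by (rule state_event) simp
  have pr: "prob (?A x) = card ?C / card (pverts G)" if x: "x \<in> pverts S" for x
  proof -
    have rv: "(\<lambda>\<omega>. \<xi> 0 \<omega> x) \<in> M \<rightarrow>\<^sub>M count_space (pverts G)"
      using x by (intro measurable_compose[OF measurable_state[OF order_refl]]) auto
    have "card ?C / card (pverts G) = measure (uniform_count_measure (pverts G)) ?C"
      using finite_opinions by (simp add: measure_uniform_count_measure)
    also have "\<dots> = measure (distr M (count_space (pverts G)) (\<lambda>\<omega>. \<xi> 0 \<omega> x)) ?C"
      using assms x by (simp add: uniform_product_initial_def)
    also have "\<dots> = prob ((\<lambda>\<omega>. \<xi> 0 \<omega> x) -` ?C \<inter> space M)"
      using rv by (intro measure_distr) auto
    also have "(\<lambda>\<omega>. \<xi> 0 \<omega> x) -` ?C \<inter> space M = ?A x" by auto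
    finally show ?thesis by simp
  qed
  have "expectation (\<lambda>\<omega>. real (card {x \<in> pverts S. eccentricity G (\<xi> 0 \<omega> x) \<le> \<tau>}))
    = expectation (\<lambda>\<omega>. \<Sum>x\<in>pverts S. indicator (?A x) \<omega>)"
  proof (intro Bochner_Integration.integral_cong refl)
    fix \<omega> assume \<omega>: "\<omega> \<in> space M"
    have "(\<Sum>x\<in>pverts S. indicator (?A x) \<omega>) = (\<Sum>x\<in>pverts S. of_bool (eccentricity G (\<xi> 0 \<omega> x) \<le> \<tau>) :: real)"
      using \<omega> state_in[OF \<omega> order_refl] by (intro sum.cong) (auto simp: indicator_def)
    then show "real (card {x \<in> pverts S. eccentricity G (\<xi> 0 \<omega> x) \<le> \<tau>}) = (\<Sum>x\<in>pverts S. indicator (?A x) \<omega>)"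
      using finite_verts by (simp add: Int_def)
  qed
  also have "\<dots> = (\<Sum>x\<in>pverts S. prob (?A x))"
    using ev by (subst Bochner_Integration.integral_sum) (auto simp: emeasure_eq_measure sets.Int_space_eq2)
  also have "\<dots> = card (pverts S) * (card ?C / card (pverts G))"
  proof -
    have "(\<Sum>x\<in>pverts S. prob (?A x)) = (\<Sum>x\<in>pverts S. card ?C / card (pverts G))"
      by (intro sum.cong refl pr)
    then show ?thesis by simp
  qed
  finally show ?thesis .
qed

end

theorem theorem2:
  fixes M :: "'w measure"
    and S :: "'v pair_pre_digraph"
    and G :: "'o pair_pre_digraph"
    and \<tau> :: nat
    and N :: "'v \<times> 'v \<Rightarrow> real \<Rightarrow> 'w \<Rightarrow> nat"
    and \<xi> :: "real \<Rightarrow> 'w \<Rightarrow> 'v \<Rightarrow> 'o"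
  assumes "pair_graph S" and "Digraph_Component.connected (with_proj S)"
    and "pair_graph G" and "Digraph_Component.connected (with_proj G)"
    and "imitation_process M S G \<tau> N \<xi>"
    and "graph_radius G \<le> \<tau>" and "\<tau> < graph_diameter G"
  shows "measure M (consensus_event M S G \<xi>)
           \<ge> (\<integral>\<omega>. real (card {x \<in> pverts S. eccentricity G (\<xi> 0 \<omega> x) \<le> \<tau>}) \<partial>M)
               / real (card (pverts S)) \<and>
         (uniform_product_initial M S G (\<xi> 0) \<longrightarrow>
           measure M (consensus_event M S G \<xi>)
             \<ge> real (card {a \<in> pverts G. eccentricity G a \<le> \<tau>}) / real (card (pverts G)) \<and>
           real (card {a \<in> pverts G. eccentricity G a \<le> \<tau>}) / real (card (pverts G)) > 0)"
proof -
  interpret connected_imitation_process M S G \<tau> N \<xi>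
    using assms(1-5) by (intro connected_imitation_process.intro connected_imitation_process_axioms.intro)
  have main: "expectation (\<lambda>\<omega>. real (card {x \<in> pverts S. eccentricity G (\<xi> 0 \<omega> x) \<le> \<tau>})) / card (pverts S)
    \<le> prob (consensus_event M S G \<xi>)"
    using expectation_card_central_le card_verts_pos by (simp add: field_simps)
  \<comment> \<open>The radius is attained as a minimum over a finite nonempty set, so
    \<open>graph_radius G \<le> \<tau>\<close> provides a central opinion and the lower bound is
    positive.\<close>
  have "graph_radius G \<in> eccentricity G ` pverts G"
    unfolding graph_radius_def using finite_opinions opinions_nonempty by (intro Min_in) auto
  then have "{a \<in> pverts G. eccentricity G a \<le> \<tau>} \<noteq> {}"
    using assms(6) by auto
  then have "0 < real (card {a \<in> pverts G. eccentricity G a \<le> \<tau>}) / real (card (pverts G))"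
    using finite_opinions opinions_nonempty by (auto simp: card_gt_0_iff)
  with main show ?thesis
    using expectation_card_central_uniform card_verts_pos by auto
qed

end
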